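(* Let $\gamma\in(\frac16,\frac14]$. Suppose $\alpha(n)\downarrow 0$ and $\beta(n)\downarrow 0$ as $n\to\infty$, that $X$ satisfies the Linnik condition of order $\gamma$, and that $\alpha(n),\beta(n)$ satisfy the Osipov-type condition of order $\gamma$. Then $$P_\mu\big(ACI^u(1)\text{ does not cover }\mu\big)\sim\alpha(n),\quad n\to\infty,$$ and $$P_{\mu_{1,n}(1)}\big(ACI^u(1)\text{ covers }\mu\big)\sim\beta(n),\quad n\to\infty.$$
   Context: Let $X,X_1,X_2,\dots$ be i.i.d. real random variables with common law from a shift family $P_\mu=P(\cdot-\mu)$, $\mu\in\mathbb{R}$, where under $P_\mu$ the expectation equals $\mu$ and the variance is $\sigma^2\in(0,\infty)$. The symbol $P_\mu$ is also used for the joint law of the sample when the common law is $P_\mu$; $E_\mu$ is the corresponding expectation. $\bar X_n=\frac1n\sum_{i=1}^nX_i$. The skewness is $g_1=E(X-E X)^3/\sigma^3$ (independent of $\mu$). $z_q$ denotes the quantile of order $q$ of the standard Gaussian distribution. $f(n)\sim g(n)$ means $f(n)/g(n)\to1$. $\alpha(n),\beta(n)\in(0,1)$ are sequences. Linnik condition of order $\gamma>0$: $E_\mu\exp\{|X-\mu|^{4\gamma/(2\gamma+1)}\}<\infty$. Osipov-type condition of order $\gamma$: $n^{\gamma}\exp\{n^{2\gamma}/2\}\cdot\min\{\alpha(n),\beta(n)\}\to\infty$ and $\max\{z_{1-\alpha(n)},z_{1-\beta(n)}\}=o(n^\gamma)$ as $n\to\infty$. First kind adjusted quantile: $z_{1-\alpha(n)}(1)=z_{1-\alpha(n)}+\frac{g_1}{6\sqrt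 n}z_{1-\alpha(n)}^2$. First kind adjusted upper asymptotic confidence interval: $ACI^u(1)=[\bar X_n-\frac{\sigma}{\sqrt n}z_{1-\alpha(n)}(1),\infty)$. First kind modified local non-true parameter: $\mu_{1,n}(1)=\mu_{1,n}+\frac{\sigma g_1}{6n}\big(z_{1-\alpha(n)}^2-z_{\beta(n)}^2\big)$, where $\mu_{1,n}=\mu+\frac{\sigma}{\sqrt n}(z_{1-\alpha(n)}-z_{\beta(n)})$. *)

theory Defs
  imports "HOL-Probability.Probability" "HOL-Library.Landau_Symbols"
begin

text \<open>The member \<open>P(\<cdot> - m)\<close> of the shift family of \<open>P\<close>: the law of \<open>Y + m\<close> when \<open>Y\<close> has law \<open>P\<close>.\<close>

definition shift_law :: "real measure \<Rightarrow> real \<Rightarrow> real measure" where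
  "shift_law P m = distr P borel (\<lambda>x. x + m)"

definition shift_family :: "real measure \<Rightarrow> real \<Rightarrow> bool" where
  "shift_family P \<sigma> \<longleftrightarrow> real_distribution P \<and> \<sigma> > 0 \<and>
     (\<forall>m. integrable (shift_law P m) (\<lambda>x. x) \<and>
          prob_space.expectation (shift_law P m) (\<lambda>x. x) = m \<and>
          integrable (shift_law P m) (\<lambda>x. (x - m)\<^sup>2) \<and>
          prob_space.variance (shift_law P m) (\<lambda>x. x) = \<sigma>\<^sup>2)"

text \<open>Joint law of an infinite i.i.d. sequence with common law \<open>shift_law P m\<close>. The observations
  are the coordinates \<open>x 1, x 2, \<dots>\<close>; coordinate \<open>x 0\<close> is never used.\<close>

definition sample_law :: "real measure \<Rightarrow> real \<Rightarrow> (nat \<Rightarrow> real) measure" where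
  "sample_law P m = (\<Pi>\<^sub>M i\<in>UNIV. shift_law P m)"

definition sample_mean :: "nat \<Rightarrow> (nat \<Rightarrow> real) \<Rightarrow> real" where
  "sample_mean n x = (\<Sum>i=1..n. x i) / real n"

definition skewness :: "real measure \<Rightarrow> real" where
  "skewness M = prob_space.expectation M (\<lambda>x. (x - prob_space.expectation M (\<lambda>y. y)) ^ 3)
                / sqrt (prob_space.variance M (\<lambda>x. x)) ^ 3"

definition gauss_quantile :: "real \<Rightarrow> real" where
  "gauss_quantile q = Inf {x. q \<le> cdf std_normal_distribution x}"

definition linnik_condition :: "real \<Rightarrow> real measure \<Rightarrow> real \<Rightarrow> bool" where
  "linnik_condition \<gamma> M m \<longleftrightarrow>
     integrable M (\<lambda>x. exp (\<bar>x - m\<bar> powr (4 * \<gamma> / (2 * \<gamma> + 1))))"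

definition osipov_condition :: "real \<Rightarrow> (nat \<Rightarrow> real) \<Rightarrow> (nat \<Rightarrow> real) \<Rightarrow> bool" where
  "osipov_condition \<gamma> \<alpha> \<beta> \<longleftrightarrow>
     filterlim (\<lambda>n. real n powr \<gamma> * exp (real n powr (2 * \<gamma>) / 2) * min (\<alpha> n) (\<beta> n))
       at_top sequentially \<and>
     (\<lambda>n. max (gauss_quantile (1 - \<alpha> n)) (gauss_quantile (1 - \<beta> n))) \<in> o(\<lambda>n. real n powr \<gamma>)"

text \<open>In what follows \<open>g\<close> stands for the skewness and \<open>a\<close>, \<open>b\<close> for the levels \<open>\<alpha>(n)\<close>, \<open>\<beta>(n)\<close>.\<close>

definition adj_quantile1 :: "real \<Rightarrow> real \<Rightarrow> nat \<Rightarrow> real" where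
  "adj_quantile1 g a n =
     gauss_quantile (1 - a) + g / (6 * sqrt (real n)) * (gauss_quantile (1 - a))\<^sup>2"

definition ACI_upper1 :: "real \<Rightarrow> real \<Rightarrow> real \<Rightarrow> nat \<Rightarrow> (nat \<Rightarrow> real) \<Rightarrow> real set" where
  "ACI_upper1 \<sigma> g a n x = {sample_mean n x - \<sigma> / sqrt (real n) * adj_quantile1 g a n ..}"

definition local_param :: "real \<Rightarrow> real \<Rightarrow> real \<Rightarrow> real \<Rightarrow> nat \<Rightarrow> real" where
  "local_param \<mu> \<sigma> a b n =
     \<mu> + \<sigma> / sqrt (real n) * (gauss_quantile (1 - a) - gauss_quantile b)"

definition local_param1 :: "real \<Rightarrow> real \<Rightarrow> real \<Rightarrow> real \<Rightarrow> real \<Rightarrow> nat \<Rightarrow> real" where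
  "local_param1 \<mu> \<sigma> g a b n = local_param \<mu> \<sigma> a b n
     + \<sigma> * g / (6 * real n) * ((gauss_quantile (1 - a))\<^sup>2 - (gauss_quantile b)\<^sup>2)"

end

theory Submission
  imports Defs "HOL-Real_Asymp.Real_Asymp"
begin

text \<open>
  Both claims are the same moderate deviation statement, applied to the standardised observations
  and to their negatives. Let \<open>S\<close> be the sum of \<open>n\<close> standardised variables \<open>Y\<close>, let \<open>x = z\<^bsub>1-a(n)\<^esub>\<close> and
  \<open>u = x + g x\<^sup>2 / (6 \<surd>n)\<close>. Truncate at \<open>T = x \<surd>n\<close>, which costs a negligible \<open>n P(|Y| > T)\<close> by the Linnik
  condition, and tilt the truncated law by \<open>exp (h y)\<close> with \<open>h = x / \<surd>n\<close>. Since \<open>n h\<^sup>4\<close> tends to \<open>0\<close>, the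
  third order expansion of the truncated moment generating function at \<open>h + i \<eta> / \<surd>n\<close> shows that
  \<open>exp (x\<^sup>2 / 2)\<close> times the tilted law of \<open>W = S / \<surd>n - u\<close> has a characteristic function converging to
  \<open>exp (- \<eta>\<^sup>2 / 2)\<close>, with Gaussian domination for \<open>|\<eta>| \<le> c \<surd>n\<close>; the quadratic term of \<open>u\<close> is exactly what cancels the
  skewness. It remains to evaluate \<open>exp (- x W)\<close> on \<open>W > 0\<close> under this law. Because \<open>x\<^sup>2 = o(\<surd>n)\<close>, the scale
  \<open>1 / x\<close> is coarse enough for a local limit argument: weighted with the Cauchy kernel \<open>1 / (1 + t\<^sup>2)\<close>, whose
  Fourier transform decays exponentially, the law of \<open>x W\<close> converges weakly to a Cauchy distribution.
  This gives \<open>P(W > 0) \<sim> exp (- x\<^sup>2 / 2) / (x \<surd>(2 \<pi>))\<close>, which is asymptotic to \<open>a(n)\<close> by Mills' ratio.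
\<close>

section \<open>A local limit theorem with Cauchy weights\<close>

lemma integrable_exp_minus_abs: "integrable lborel (\<lambda>x::real. exp (- \<bar>x\<bar>))"
proof -
  have *: "integrable lborel (\<lambda>x::real. exp (- x) * indicator {0..} x)"
    using has_bochner_integral_I0i_power_exp_m'[of 0] by (auto simp: has_bochner_integral_iff)
  have **: "integrable lborel (\<lambda>x::real. exp x * indicator {0..} (- x))"
    using lborel_integrable_real_affine[OF *, of "-1" 0] by simp
  show ?thesis
    by (rule Bochner_Integration.integrable_bound[OF Bochner_Integration.integrable_add[OF * **]])
       (auto simp: indicator_def)
qed

lemma integrable_laplace_kernel: "integrable lborel (\<lambda>\<xi>::real. complex_of_real (exp (- \<bar>\<xi>\<bar>)) * iexp (\<xi> * t))"
  by (rule Bochner_Integration.integrable_bound[OF integrable_exp_minus_abs]) (auto simp: norm_mult)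

lemma half_laplace_kernel_integral:
  "(LINT \<xi>|lborel. indicator {0<..} \<xi> *\<^sub>R (complex_of_real (exp (- \<xi>)) * iexp (\<xi> * t))) = 1 / (1 - \<i> * t)"
proof -
  let ?f = "\<lambda>\<xi>::real. complex_of_real (exp (- \<xi>)) * iexp (\<xi> * t)"
  \<comment> \<open>An antiderivative of the integrand, because
    \<open>\<i> * t - 1 = - (1 - \<i> * t)\<close>. Its modulus is a constant times
    \<open>exp (- \<xi>)\<close>, so it vanishes at infinity and only \<open>- F 0\<close>
    remains.\<close>
  define F where "F \<xi> = - exp (of_real \<xi> * (\<i> * t - 1)) / (1 - \<i> * t)" for \<xi> :: real
  have nz: "1 - \<i> * t \<noteq> 0" by (simp add: complex_eq_iff)
  have f: "?f = (\<lambda>\<xi>. exp (of_real \<xi> * (\<i> * t - 1)))"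
    by (auto simp: exp_of_real[symmetric] exp_add[symmetric] algebra_simps fun_eq_iff)
  have "(LBINT \<xi>=0..\<infinity>. ?f \<xi>) = 0 - F 0"
  proof (rule interval_integral_FTC_integrable)
    show "(F has_vector_derivative ?f x) (at x)" for x
    proof -
      have "((\<lambda>\<xi>. exp (\<xi> *\<^sub>R (\<i> * t - 1)) * (- 1 / (1 - \<i> * t))) has_vector_derivative
          exp (x *\<^sub>R (\<i> * t - 1)) * (\<i> * t - 1) * (- 1 / (1 - \<i> * t))) (at x)"
        by (intro has_vector_derivative_mult_left exp_scaleR_has_vector_derivative_right)
      moreover have "(\<i> * t - 1) * (- 1 / (1 - \<i> * t)) = 1" using nz by (simp add: field_simps)
      moreover have "F = (\<lambda>\<xi>. exp (\<xi> *\<^sub>R (\<i> * t - 1)) * (- 1 / (1 - \<i> * t)))"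
        by (auto simp: F_def scaleR_conv_of_real fun_eq_iff)
      moreover have "?f x = exp (x *\<^sub>R (\<i> * t - 1))"
        using fun_cong[OF f, of x] by (simp only: scaleR_conv_of_real)
      ultimately show ?thesis by (simp only: mult.assoc mult_1_right)
    qed
    show "isCont ?f x" for x by (intro continuous_intros)
    show "set_integrable lborel (einterval 0 \<infinity>) ?f" unfolding set_integrable_def
      by (rule Bochner_Integration.integrable_bound[OF integrable_exp_minus_abs])
         (auto simp: norm_mult indicator_def einterval_def)
    show "((F \<circ> real_of_ereal) \<longlongrightarrow> F 0) (at_right 0)"
      unfolding zero_ereal_def ereal_tendsto_simps F_def using nz by (auto intro!: tendsto_eq_intros)
    have "((\<lambda>\<xi>. exp (- \<xi>) :: real) \<longlongrightarrow> 0) at_top"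
      by (intro exp_at_bot[THEN filterlim_compose] filterlim_uminus_at_bot_at_top)
    then have "(F \<longlongrightarrow> 0) at_top"
    proof (rule Lim_null_comparison[OF always_eventually, OF allI, rotated, OF tendsto_mult_left_zero])
      show "norm (F \<xi>) \<le> exp (- \<xi>) * (1 / norm (1 - \<i> * t))" for \<xi>
        by (simp add: F_def norm_divide norm_mult)
    qed
    then show "((F \<circ> real_of_ereal) \<longlongrightarrow> 0) (at_left \<infinity>)"
      unfolding ereal_tendsto_simps .
  qed auto
  then show ?thesis
    by (simp add: interval_lebesgue_integral_0_infty set_lebesgue_integral_def F_def)
qed

text \<open>The positive half-line contributes \<open>1 / (1 - \<i> * t)\<close> and the negative
  one, after reflection, its conjugate. This turns integrals of a characteristic function against an
  exponential kernel into Cauchy-weighted integrals of the law itself.\<close>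

lemma laplace_kernel_integral:
  "(LINT \<xi>|lborel. complex_of_real (exp (- \<bar>\<xi>\<bar>)) * iexp (\<xi> * t)) = 2 / (1 + t\<^sup>2)"
proof -
  let ?f = "\<lambda>t \<xi>::real. complex_of_real (exp (- \<bar>\<xi>\<bar>)) * iexp (\<xi> * t)"
  let ?h = "\<lambda>t. (LINT \<xi>|lborel. indicator {0<..} \<xi> *\<^sub>R ?f t \<xi>)"
  have h: "?h t = 1 / (1 - \<i> * t)" for t
    unfolding half_laplace_kernel_integral[symmetric] by (intro Bochner_Integration.integral_cong) (auto simp: indicator_def)
  have int: "integrable lborel (\<lambda>\<xi>. indicator A \<xi> *\<^sub>R ?f t \<xi>)" if "A \<in> sets borel" for A t
    using integrable_mult_indicator[OF _ integrable_laplace_kernel] that by auto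
  have "(LINT \<xi>|lborel. ?f t \<xi>) = (LINT \<xi>|lborel. indicator {0<..} \<xi> *\<^sub>R ?f t \<xi> + indicator {..<0} \<xi> *\<^sub>R ?f t \<xi>)"
    by (rule integral_cong_AE) (use AE_lborel_singleton[of 0] in \<open>auto simp: indicator_def\<close>)
  also have "\<dots> = ?h t + (LINT \<xi>|lborel. indicator {..<0} \<xi> *\<^sub>R ?f t \<xi>)"
    by (intro Bochner_Integration.integral_add int) auto
  also have "(LINT \<xi>|lborel. indicator {..<0} \<xi> *\<^sub>R ?f t \<xi>) = ?h (-t)"
    by (subst lborel_integral_real_affine[of "-1" _ 0]) (auto intro!: Bochner_Integration.integral_cong simp: indicator_def)
  also have "?h t + ?h (-t) = 2 / (1 + t\<^sup>2)"
  proof -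
    have "1 - \<i> * t \<noteq> 0" "1 + \<i> * t \<noteq> 0" by (simp_all add: complex_eq_iff)
    moreover from this have "(1 - \<i> * t) * (1 + \<i> * t) \<noteq> 0" by simp
    moreover have "(1 - \<i> * t) * (1 + \<i> * t) = 1 + (t::complex)\<^sup>2" by (simp add: algebra_simps power2_eq_square)
    ultimately have "1 + (complex_of_real t)\<^sup>2 \<noteq> 0" by (metis)
    show ?thesis unfolding h
      using \<open>1 - \<i> * t \<noteq> 0\<close> \<open>1 + \<i> * t \<noteq> 0\<close> \<open>1 + (complex_of_real t)\<^sup>2 \<noteq> 0\<close>
      by (simp add: divide_simps) (simp add: algebra_simps power2_eq_square)
  qed
  finally show ?thesis .
qed

text \<open>Substitute \<open>\<eta> = x * (\<xi> + b)\<close>: the scale \<open>x\<close> moves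
  into the Cauchy kernel and the shift \<open>b\<close> becomes a phase.\<close>

lemma scaled_laplace_kernel_integral:
  assumes "x > 0"
  shows "(LINT \<eta>|lborel. complex_of_real (exp (- \<bar>\<eta> / x - b\<bar>)) * iexp (\<eta> * v))
    = 2 * of_real x / (1 + (of_real (x * v))\<^sup>2) * iexp (b * x * v)"
proof -
  have "(LINT \<eta>|lborel. complex_of_real (exp (- \<bar>\<eta> / x - b\<bar>)) * iexp (\<eta> * v))
     = x *\<^sub>R (LINT \<xi>|lborel. complex_of_real (exp (- \<bar>\<xi>\<bar>)) * iexp (\<xi> * (x * v)) * iexp (b * x * v))"
    using assms by (subst lborel_integral_real_affine[of x _ "x * b"])
      (auto intro!: Bochner_Integration.integral_cong arg_cong[where f=exp] simp: field_simps exp_add[symmetric])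
  also have "\<dots> = 2 * of_real x / (1 + (of_real (x * v))\<^sup>2) * iexp (b * x * v)"
    using laplace_kernel_integral[of "x * v"] by (simp add: scaleR_conv_of_real)
  finally show ?thesis .
qed

lemma integrable_exp_minus_abs_affine:
  assumes "x > 0"
  shows "integrable lborel (\<lambda>\<eta>::real. exp (- \<bar>\<eta> / x - b\<bar>))"
  using lborel_integrable_real_affine[OF integrable_exp_minus_abs, of "1/x" "-b"] assms by simp

section \<open>Cauchy-weighted integrals of finite measures\<close>

lemma (in finite_measure) integrable_iexp_finite:
  assumes "f \<in> borel_measurable M"
  shows "complex_integrable M (\<lambda>x. iexp (f x))"
  using assms by (intro integrable_const_bound[of _ 1]) auto

text \<open>Fubini, justified by the integrability of the kernel and the finite mass of
  \<open>L\<close>. The right-hand side is, up to a factor, the Fourier transform at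
  \<open>b\<close> of the law of \<open>x * v\<close> weighted with the Cauchy kernel.\<close>

lemma cauchy_weighted_char_eq:
  fixes L :: "real measure"
  assumes "finite_measure L" "sets L = sets borel" "x > 0"
  shows "(LINT \<eta>|lborel. complex_of_real (exp (- \<bar>\<eta> / x - b\<bar>)) * char L \<eta>)
    = 2 * (LINT v|L. of_real (x / (1 + (x * v)\<^sup>2)) * iexp (b * (x * v)))"
proof -
  interpret L: finite_measure L by fact
  note [measurable_cong] = assms(2)
  interpret P: pair_sigma_finite lborel L ..
  have int: "complex_integrable (lborel \<Otimes>\<^sub>M L) (\<lambda>(\<eta>, v). complex_of_real (exp (- \<bar>\<eta> / x - b\<bar>)) * iexp (\<eta> * v))"
  proof (rule P.Fubini_integrable)
    show "AE \<eta> in lborel. complex_integrable L (\<lambda>v. case (\<eta>, v) of (\<eta>, v) \<Rightarrow> complex_of_real (exp (- \<bar>\<eta> / x - b\<bar>)) * iexp (\<eta> * v))"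
      unfolding split by (intro AE_I2 integrable_mult_right impI L.integrable_iexp_finite) simp
    have "integrable lborel (\<lambda>\<eta>. exp (- \<bar>\<eta> / x - b\<bar>) * measure L (space L))"
      using integrable_exp_minus_abs_affine[OF assms(3)] by (rule integrable_mult_left)
    then show "integrable lborel (\<lambda>\<eta>. LINT v|L. norm (case (\<eta>, v) of (\<eta>, v) \<Rightarrow> complex_of_real (exp (- \<bar>\<eta> / x - b\<bar>)) * iexp (\<eta> * v)))"
      by (simp add: norm_mult mult.commute)
  qed measurable
  have "(LINT \<eta>|lborel. complex_of_real (exp (- \<bar>\<eta> / x - b\<bar>)) * char L \<eta>)
     = (LINT \<eta>|lborel. LINT v|L. complex_of_real (exp (- \<bar>\<eta> / x - b\<bar>)) * iexp (\<eta> * v))"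
    by (simp add: char_def)
  also have "\<dots> = (LINT v|L. LINT \<eta>|lborel. complex_of_real (exp (- \<bar>\<eta> / x - b\<bar>)) * iexp (\<eta> * v))"
    using P.Fubini_integral[OF int] by simp
  also have "\<dots> = (LINT v|L. 2 * (of_real (x / (1 + (x * v)\<^sup>2)) * iexp (b * (x * v))))"
    unfolding scaled_laplace_kernel_integral[OF assms(3)]
    by (intro Bochner_Integration.integral_cong) (simp_all add: mult_ac)
  finally show ?thesis by (simp only: integral_mult_right_zero)
qed

lemma integrable_inverse_1_plus_square_lborel: "integrable lborel (\<lambda>x::real. 1 / (1 + x\<^sup>2))"
  and integral_inverse_1_plus_square_lborel: "(LINT x|lborel. 1 / (1 + x\<^sup>2)) = pi"
  using integrable_inverse_1_plus_square LBINT_inverse_1_plus_square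
  by (auto simp: set_integrable_def interval_lebesgue_integral_def set_lebesgue_integral_def inverse_eq_divide)

lemma gauss_integrable: "integrable lborel (\<lambda>x::real. exp (- x\<^sup>2 / a))" if "a > 0"
proof -
  have "integrable lborel (normal_density 0 (sqrt (a / 2)))" using that by simp
  from integrable_mult_right[OF this, of "sqrt (pi * a)"] show ?thesis
    using that by (simp add: normal_density_def)
qed

lemma gauss_integral: "(LINT x::real|lborel. exp (- x\<^sup>2 / 2)) = sqrt (2 * pi)"
proof -
  have "1 = (LINT x|lborel. normal_density 0 1 x)" by simp
  also have "\<dots> = (LINT x::real|lborel. (1 / sqrt (2 * pi)) * exp (- x\<^sup>2 / 2))"
    unfolding normal_density_def by (intro Bochner_Integration.integral_cong) simp_all
  finally show ?thesis by (simp add: field_simps)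
qed

text \<open>A single term of the exponential series is at most the whole sum.\<close>

lemma power_le_fact_mult_exp:
  fixes q :: real
  assumes "q \<ge> 0"
  shows "q ^ m \<le> fact m * exp q"
proof -
  have "summable (\<lambda>n. inverse (fact n) * q ^ n)" by (rule summable_exp)
  then have "(\<Sum>n\<in>{m}. inverse (fact n) * q ^ n) \<le> (\<Sum>n. inverse (fact n) * q ^ n)"
    using assms by (intro sum_le_suminf) auto
  then have "q ^ m / fact m \<le> exp q" by (simp add: exp_def divide_inverse mult.commute)
  then show ?thesis by (simp add: field_simps)
qed

text \<open>With \<open>q = sqrt s\<close>, the term of order four gives
  \<open>exp q \<ge> s\<^sup>2 / 24\<close>, and \<open>1 + s\<^sup>2 \<le> 2 * s\<^sup>2\<close>.
  The right-hand side is an integrable majorant for the kernel at high frequencies.\<close>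

lemma exp_minus_sqrt_le:
  fixes s :: real
  assumes "s \<ge> 1"
  shows "exp (- sqrt s) \<le> 48 / (1 + s\<^sup>2)"
proof -
  define q where "q = sqrt s"
  have q: "q \<ge> 1" using assms by (simp add: q_def)
  have "q ^ 4 \<le> fact 4 * exp q" using q by (intro power_le_fact_mult_exp) simp
  moreover have "q ^ 4 = s\<^sup>2"
  proof -
    have "q ^ 4 = (q\<^sup>2)\<^sup>2" by (simp flip: power_mult)
    also have "q\<^sup>2 = s" using assms by (simp add: q_def)
    finally show ?thesis .
  qed
  moreover have "1 \<le> s\<^sup>2" using assms by simp
  ultimately have "(1 + s\<^sup>2) / 48 \<le> exp q" by (simp add: fact_numeral)
  then have "1 / exp q \<le> 1 / ((1 + s\<^sup>2) / 48)"
    by (intro divide_left_mono) (auto simp: add_pos_nonneg)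
  then show ?thesis by (simp add: exp_minus q_def inverse_eq_divide)
qed


text \<open>By \<open>cauchy_weighted_char_eq\<close> the integral is half the integral of
  \<open>exp (- \<bar>\<eta> / x n - b\<bar>)\<close> times the characteristic function. As
  \<open>x n\<close> grows, the kernel tends to the constant \<open>exp (- \<bar>b\<bar>)\<close>
  and the characteristic function to the Gaussian one, whose integral is
  \<open>sqrt (2 * pi)\<close>. For domination, the assumed Gaussian bound serves the frequencies up
  to \<open>r n\<close>, and the decay of the kernel serves those beyond.\<close>

lemma cauchy_weighted_char_limit:
  fixes L :: "nat \<Rightarrow> real measure" and x r :: "nat \<Rightarrow> real"
  assumes fin: "\<And>n. finite_measure (L n)" and sets: "\<And>n. sets (L n) = sets borel"
    and x: "filterlim x at_top sequentially"
    and lim: "\<And>\<eta>. (\<lambda>n. char (L n) \<eta>) \<longlonglongrightarrow> of_real (exp (- \<eta>\<^sup>2 / 2))"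
    and C: "C \<ge> 0" and bound: "\<forall>\<^sub>F n in sequentially. \<forall>\<eta>. \<bar>\<eta>\<bar> \<le> r n \<longrightarrow> norm (char (L n) \<eta>) \<le> C * exp (- \<eta>\<^sup>2 / 4)"
    and r: "\<forall>\<^sub>F n in sequentially. (x n)\<^sup>2 \<le> r n"
  shows "(\<lambda>n. LINT v|L n. of_real (x n / (1 + (x n * v)\<^sup>2)) * iexp (b * (x n * v)))
    \<longlonglongrightarrow> of_real (sqrt (2 * pi) / 2 * exp (- \<bar>b\<bar>))"
proof -
  \<comment> \<open>The measures need not have mass one, so the trivial bound on a characteristic
    function is its value at 0, the total mass.\<close>
  have nc: "norm (char (L n) \<eta>) \<le> norm (char (L n) 0)" for n \<eta>
  proof -
    interpret finite_measure "L n" by fact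
    have "norm (char (L n) \<eta>) \<le> (LINT v|L n. norm (iexp (\<eta> * v)))"
      unfolding char_def by (rule integral_norm_bound)
    then show ?thesis by (simp add: char_def)
  qed
  have "\<forall>\<^sub>F n in sequentially. norm (char (L n) 0) < 2"
    using tendsto_norm[OF lim[of 0]] by (rule order_tendstoD) auto
  moreover have "\<forall>\<^sub>F n in sequentially. x n \<ge> 1"
    using x by (auto simp: filterlim_at_top)
  ultimately have "\<forall>\<^sub>F n in sequentially. norm (char (L n) 0) < 2 \<and> x n \<ge> 1 \<and> (x n)\<^sup>2 \<le> r n \<and>
      (\<forall>\<eta>. \<bar>\<eta>\<bar> \<le> r n \<longrightarrow> norm (char (L n) \<eta>) \<le> C * exp (- \<eta>\<^sup>2 / 4))"
    using bound r by eventually_elim auto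
  then obtain N where N: "\<And>n. n \<ge> N \<Longrightarrow> norm (char (L n) 0) < 2 \<and> x n \<ge> 1 \<and> (x n)\<^sup>2 \<le> r n \<and>
      (\<forall>\<eta>. \<bar>\<eta>\<bar> \<le> r n \<longrightarrow> norm (char (L n) \<eta>) \<le> C * exp (- \<eta>\<^sup>2 / 4))"
    by (auto simp: eventually_sequentially)
  let ?f = "\<lambda>n \<eta>. complex_of_real (exp (- \<bar>\<eta> / x n - b\<bar>)) * char (L n) \<eta>"
  have [measurable]: "char (L n) \<in> borel_measurable borel" for n
  proof -
    interpret finite_measure "L n" by fact
    note [measurable_cong] = sets[of n]
    show ?thesis unfolding char_def by measurable
  qed
  \<comment> \<open>The majorant is free of \<open>n\<close>. The factor 96 is 48 from
    \<open>exp_minus_sqrt_le\<close> times the bound 2 on the total mass.\<close>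
  have dom: "norm (?f n \<eta>) \<le> C * exp (- \<eta>\<^sup>2 / 4) + 96 * exp \<bar>b\<bar> * (1 / (1 + \<eta>\<^sup>2))" if "n \<ge> N" for n \<eta>
  proof (cases "\<bar>\<eta>\<bar> \<le> r n")
    case True
    then have "norm (char (L n) \<eta>) \<le> C * exp (- \<eta>\<^sup>2 / 4)" using N[OF that] by blast
    then have "norm (?f n \<eta>) \<le> 1 * (C * exp (- \<eta>\<^sup>2 / 4))"
      unfolding norm_mult by (intro mult_mono) auto
    moreover have "0 \<le> 96 * exp \<bar>b\<bar> * (1 / (1 + \<eta>\<^sup>2))" by simp
    ultimately show ?thesis by linarith
  next
    case False
    \<comment> \<open>Beyond \<open>r n\<close> the frequency exceeds \<open>(x n)\<^sup>2\<close>,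
      so \<open>\<bar>\<eta>\<bar> / x n\<close> is at least \<open>sqrt \<bar>\<eta>\<bar>\<close>
      and the kernel decays uniformly in \<open>n\<close>.\<close>
    have x1: "x n \<ge> 1" and x2: "(x n)\<^sup>2 \<le> \<bar>\<eta>\<bar>" using N[OF that] False by auto
    then have s: "x n \<le> sqrt \<bar>\<eta>\<bar>" by (simp add: real_le_rsqrt)
    have e1: "\<bar>\<eta>\<bar> \<ge> 1" using x2 one_le_power[OF x1, of 2] by linarith
    have "sqrt \<bar>\<eta>\<bar> = \<bar>\<eta>\<bar> / sqrt \<bar>\<eta>\<bar>" using e1 by (simp add: real_div_sqrt)
    also have "\<dots> \<le> \<bar>\<eta>\<bar> / x n" using s x1 e1 by (intro divide_left_mono mult_pos_pos) auto
    also have "\<dots> = \<bar>\<eta> / x n\<bar>" using x1 by simp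
    finally have "exp (- \<bar>\<eta> / x n - b\<bar>) \<le> exp (\<bar>b\<bar> - sqrt \<bar>\<eta>\<bar>)" by simp
    also have "\<dots> = exp \<bar>b\<bar> * exp (- sqrt \<bar>\<eta>\<bar>)" by (simp flip: exp_add)
    also have "\<dots> \<le> exp \<bar>b\<bar> * (48 / (1 + \<eta>\<^sup>2))" using exp_minus_sqrt_le[OF e1] by (intro mult_left_mono) simp_all
    finally have "exp (- \<bar>\<eta> / x n - b\<bar>) * norm (char (L n) \<eta>) \<le> exp \<bar>b\<bar> * (48 / (1 + \<eta>\<^sup>2)) * 2"
      using N[OF that] nc[of n \<eta>] by (intro mult_mono) auto
    moreover have "0 \<le> C * exp (- \<eta>\<^sup>2 / 4)" using C by simp
    ultimately show ?thesis by (simp add: norm_mult)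
  qed
  \<comment> \<open>The majorant is valid only from \<open>N\<close> on, whereas dominated
    convergence asks for it at every index; hence the shift.\<close>
  have "(\<lambda>n. LINT \<eta>|lborel. ?f (n + N) \<eta>) \<longlonglongrightarrow> (LINT \<eta>|lborel. of_real (exp (- \<bar>b\<bar>) * exp (- \<eta>\<^sup>2 / 2)))"
  proof (rule integral_dominated_convergence)
    show "integrable lborel (\<lambda>\<eta>. C * exp (- \<eta>\<^sup>2 / 4) + 96 * exp \<bar>b\<bar> * (1 / (1 + \<eta>\<^sup>2)))"
      by (intro Bochner_Integration.integrable_add integrable_mult_right gauss_integrable
          integrable_inverse_1_plus_square_lborel) simp
    show "AE \<eta> in lborel. (\<lambda>n. ?f (n + N) \<eta>) \<longlonglongrightarrow> of_real (exp (- \<bar>b\<bar>) * exp (- \<eta>\<^sup>2 / 2))"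
    proof (rule AE_I2)
      fix \<eta> :: real
      have "(\<lambda>n. \<eta> / x n) \<longlonglongrightarrow> 0"
        by (rule tendsto_divide_0[OF tendsto_const filterlim_at_top_imp_at_infinity[OF x]])
      then have "(\<lambda>n. exp (- \<bar>\<eta> / x n - b\<bar>)) \<longlonglongrightarrow> exp (- \<bar>0 - b\<bar>)"
        by (intro tendsto_intros)
      then have "(\<lambda>n. ?f n \<eta>) \<longlonglongrightarrow> of_real (exp (- \<bar>b\<bar>)) * of_real (exp (- \<eta>\<^sup>2 / 2))"
        using lim by (intro tendsto_mult tendsto_of_real) auto
      then show "(\<lambda>n. ?f (n + N) \<eta>) \<longlonglongrightarrow> of_real (exp (- \<bar>b\<bar>) * exp (- \<eta>\<^sup>2 / 2))"
        unfolding of_real_mult by (rule LIMSEQ_ignore_initial_segment)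
    qed
  qed (use dom in auto)
  then have "(\<lambda>n. LINT \<eta>|lborel. ?f n \<eta>) \<longlonglongrightarrow> of_real (exp (- \<bar>b\<bar>) * sqrt (2 * pi))"
    unfolding integral_complex_of_real gauss_integral[symmetric] integral_mult_right_zero
    by (rule LIMSEQ_offset)
  then have "(\<lambda>n. 1 / 2 * (LINT \<eta>|lborel. ?f n \<eta>)) \<longlonglongrightarrow> 1 / 2 * of_real (exp (- \<bar>b\<bar>) * sqrt (2 * pi))"
    by (rule tendsto_mult_left)
  moreover have "\<forall>\<^sub>F n in sequentially. 1 / 2 * (LINT \<eta>|lborel. ?f n \<eta>)
      = (LINT v|L n. of_real (x n / (1 + (x n * v)\<^sup>2)) * iexp (b * (x n * v)))"
    using eventually_ge_at_top[of N]
  proof eventually_elim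
    case (elim n)
    then have "x n > 0" using N[OF elim] by auto
    from cauchy_weighted_char_eq[OF fin sets this] show ?case by simp
  qed
  ultimately have "(\<lambda>n. LINT v|L n. of_real (x n / (1 + (x n * v)\<^sup>2)) * iexp (b * (x n * v)))
    \<longlonglongrightarrow> 1 / 2 * of_real (exp (- \<bar>b\<bar>) * sqrt (2 * pi))"
    by (rule Lim_transform_eventually)
  then show ?thesis by (simp add: mult_ac)
qed

section \<open>The Cauchy distribution and its characteristic function\<close>

definition cauchy_distribution :: "real measure" where
  "cauchy_distribution = density lborel (\<lambda>t. ennreal (1 / (pi * (1 + t\<^sup>2))))"

lemma integral_cauchy_distribution:
  fixes f :: "real \<Rightarrow> 'a :: {banach, second_countable_topology}"
  assumes [measurable]: "f \<in> borel_measurable borel"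
  shows "(LINT t|cauchy_distribution. f t) = (LINT t|lborel. (1 / (pi * (1 + t\<^sup>2))) *\<^sub>R f t)"
  unfolding cauchy_distribution_def by (rule integral_density) (auto simp: add_pos_nonneg)

lemma real_distribution_cauchy: "real_distribution cauchy_distribution"
proof -
  have "integrable lborel (\<lambda>t::real. 1 / pi * (1 / (1 + t\<^sup>2)))"
    by (intro integrable_mult_right integrable_inverse_1_plus_square_lborel)
  moreover have "(LINT t::real|lborel. 1 / pi * (1 / (1 + t\<^sup>2))) = 1"
    unfolding integral_mult_right_zero integral_inverse_1_plus_square_lborel by simp
  ultimately have "(\<integral>\<^sup>+t. ennreal (1 / (pi * (1 + t\<^sup>2))) \<partial>(lborel :: real measure)) = 1"
    by (subst nn_integral_eq_integral) (auto simp: add_pos_nonneg)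
  then have "prob_space cauchy_distribution"
    by (intro prob_spaceI) (simp add: cauchy_distribution_def emeasure_density)
  then show ?thesis
    by (simp add: real_distribution_def real_distribution_axioms_def cauchy_distribution_def)
qed

text \<open>The limit \<open>cauchy_weighted_char_limit\<close> is applied to the constant sequence
  of standard normal laws with scales \<open>n + 1\<close>. Rescaling the same integrals by
  \<open>t = (n + 1) * v\<close> flattens the normal density to its value at 0, so they also
  converge to a multiple of the Cauchy characteristic function. Comparing the two limits determines
  it.\<close>

lemma char_cauchy_distribution: "char cauchy_distribution b = of_real (exp (- \<bar>b\<bar>))"
proof -
  let ?x = "\<lambda>n. real (Suc n)"
  let ?w = "\<lambda>t. complex_of_real (1 / (1 + t\<^sup>2)) * iexp (b * t)"
  let ?G = "\<lambda>n. LINT v|std_normal_distribution. of_real (?x n / (1 + (?x n * v)\<^sup>2)) * iexp (b * (?x n * v))"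
  have "?G \<longlonglongrightarrow> of_real (sqrt (2 * pi) / 2 * exp (- \<bar>b\<bar>))"
  \<comment> \<open>The characteristic function is exactly
    \<open>exp (- \<eta>\<^sup>2 / 2)\<close>, so the Gaussian bound holds at all frequencies with
    constant 1 and the smallest admissible \<open>r\<close> can be taken.\<close>
  proof (rule cauchy_weighted_char_limit[where C = 1 and r = "\<lambda>n. (?x n)\<^sup>2"])
    show "filterlim ?x at_top sequentially"
      using filterlim_compose[OF filterlim_real_sequentially filterlim_Suc] by simp
    show "finite_measure std_normal_distribution"
      using real_dist_normal_dist by (simp add: real_distribution_def prob_space_def)
  qed (auto simp: char_std_normal_distribution)
  moreover have G: "?G n = (LINT t|lborel. std_normal_density (t / ?x n) *\<^sub>R ?w t)" for n
  proof -
    have "?G n = (LINT v|lborel. std_normal_density v *\<^sub>R (of_real (?x n / (1 + (?x n * v)\<^sup>2)) * iexp (b * (?x n * v))))"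
      by (rule integral_density) auto
    also have "\<dots> = ?x n *\<^sub>R (LINT v|lborel. std_normal_density v *\<^sub>R (of_real (1 / (1 + (?x n * v)\<^sup>2)) * iexp (b * (?x n * v))))"
      unfolding integral_scaleR_right[symmetric]
      by (intro Bochner_Integration.integral_cong) (simp_all add: scaleR_conv_of_real)
    also have "\<dots> = (LINT t|lborel. std_normal_density (t / ?x n) *\<^sub>R ?w t)"
      by (subst (2) lborel_integral_real_affine[of "?x n" _ 0]) (simp_all)
    finally show ?thesis .
  qed
  moreover have "(\<lambda>n. LINT t|lborel. std_normal_density (t / ?x n) *\<^sub>R ?w t) \<longlonglongrightarrow> (LINT t|lborel. std_normal_density 0 *\<^sub>R ?w t)"
  proof (rule integral_dominated_convergence)
    show "integrable lborel (\<lambda>t. 1 * (1 / (1 + t\<^sup>2)) :: real)"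
      by (intro integrable_mult_right integrable_inverse_1_plus_square_lborel)
    show "AE t in lborel. (\<lambda>n. std_normal_density (t / ?x n) *\<^sub>R ?w t) \<longlonglongrightarrow> std_normal_density 0 *\<^sub>R ?w t"
    proof (intro AE_I2 tendsto_scaleR tendsto_const)
      fix t :: real
      have "(\<lambda>n. t / ?x n) \<longlonglongrightarrow> 0" by real_asymp
      then show "(\<lambda>n. std_normal_density (t / ?x n)) \<longlonglongrightarrow> std_normal_density 0"
        unfolding normal_density_def by (intro tendsto_intros) auto
    qed
    show "AE t in lborel. norm (std_normal_density (t / ?x n) *\<^sub>R ?w t) \<le> 1 * (1 / (1 + t\<^sup>2))" for n
    proof (rule AE_I2)
      fix t :: real
      have "std_normal_density (t / ?x n) \<le> 1"
        unfolding std_normal_density_def using pi_ge_two by (intro mult_le_one) (auto simp: real_le_rsqrt)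
      then show "norm (std_normal_density (t / ?x n) *\<^sub>R ?w t) \<le> 1 * (1 / (1 + t\<^sup>2))"
        unfolding norm_scaleR norm_mult norm_of_real norm_exp_i_times mult_1_right
        by (intro mult_mono) (auto simp: add_pos_nonneg)
    qed
  qed auto
  ultimately have "(LINT t|lborel. std_normal_density 0 *\<^sub>R ?w t) = of_real (sqrt (2 * pi) / 2 * exp (- \<bar>b\<bar>))"
    by (simp only: LIMSEQ_unique)
  moreover have "(LINT t|lborel. std_normal_density 0 *\<^sub>R ?w t) = of_real (pi / sqrt (2 * pi)) * char cauchy_distribution b"
    unfolding char_def
    by (subst integral_cauchy_distribution)
       (auto simp: std_normal_density_def scaleR_conv_of_real simp flip: integral_mult_right_zero intro!: Bochner_Integration.integral_cong)
  ultimately have "of_real (pi / sqrt (2 * pi)) * char cauchy_distribution b = complex_of_real (sqrt (2 * pi) / 2 * exp (- \<bar>b\<bar>))"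
    by (simp only:)
  also have "sqrt (2 * pi) / 2 = pi / sqrt (2 * pi)" by (simp add: field_simps)
  finally show ?thesis by (simp add: mult_cancel_left)
qed

text \<open>The Cauchy-weighted law of \<open>x n * v\<close>, normalised to mass one, converges
  weakly to the Cauchy distribution by Levy's continuity theorem. Testing it against
  \<open>exp (- t) * (1 + t\<^sup>2)\<close> on \<open>B\<close> cancels the weight and leaves the
  wanted integral. The Cauchy integral of this test function is \<open>1 / pi\<close>, and the
  normalising mass tends to \<open>sqrt (2 * pi) / 2\<close>.\<close>

lemma exponential_tail_limit:
  fixes L :: "nat \<Rightarrow> real measure" and x r :: "nat \<Rightarrow> real"
  assumes fin: "\<And>n. finite_measure (L n)" and sets: "\<And>n. sets (L n) = sets borel"
    and x: "filterlim x at_top sequentially"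
    and lim: "\<And>\<eta>. (\<lambda>n. char (L n) \<eta>) \<longlonglongrightarrow> of_real (exp (- \<eta>\<^sup>2 / 2))"
    and C: "C \<ge> 0" and bound: "\<forall>\<^sub>F n in sequentially. \<forall>\<eta>. \<bar>\<eta>\<bar> \<le> r n \<longrightarrow> norm (char (L n) \<eta>) \<le> C * exp (- \<eta>\<^sup>2 / 4)"
    and r: "\<forall>\<^sub>F n in sequentially. (x n)\<^sup>2 \<le> r n"
    and B: "{0<..} \<subseteq> B" "B \<subseteq> {0..}"
  shows "(\<lambda>n. x n * (LINT v|L n. exp (- (x n * v)) * indicator B v)) \<longlonglongrightarrow> 1 / sqrt (2 * pi)"
proof -
  let ?D = "\<lambda>n. LINT v|L n. x n / (1 + (x n * v)\<^sup>2)"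
  have "(\<lambda>n. of_real (?D n)) \<longlonglongrightarrow> complex_of_real (sqrt (2 * pi) / 2)"
    using cauchy_weighted_char_limit[OF fin sets x lim C bound r, of 0]
    by (simp only: mult_zero_left of_real_0 mult_zero_right exp_zero mult_1_right integral_complex_of_real abs_zero minus_zero)
  then have D: "?D \<longlonglongrightarrow> sqrt (2 * pi) / 2" by (simp only: tendsto_of_real_iff)
  have "\<forall>\<^sub>F n in sequentially. ?D n > 0" using D by (rule order_tendstoD) simp
  moreover have "\<forall>\<^sub>F n in sequentially. x n > 0" using x by (auto simp: filterlim_at_top_dense)
  ultimately have "\<forall>\<^sub>F n in sequentially. ?D n > 0 \<and> x n > 0" by eventually_elim auto
  then obtain N where N: "\<And>n. n \<ge> N \<Longrightarrow> ?D n > 0" "\<And>n. n \<ge> N \<Longrightarrow> x n > 0"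
    by (auto simp: eventually_sequentially)
  \<comment> \<open>Dividing by the mass \<open>?D n\<close> makes the weighted law a probability
    measure, as the continuity theorem requires; \<open>?D n\<close> is positive from
    \<open>N\<close> on.\<close>
  define K where "K n = density (distr (L n) borel (\<lambda>v. x n * v)) (\<lambda>t. ennreal (x n / (1 + t\<^sup>2) / ?D n))" for n
  \<comment> \<open>The inclusions leave only the open and the closed half-line, so strict and
    non-strict tail events are treated together.\<close>
  have B': "B = {0<..} \<or> B = {0..}"
  proof (cases "0 \<in> B")
    case True
    have "{0..} \<subseteq> B" using B True by (auto simp: order_le_less)
    then show ?thesis using B by blast
  next
    case False
    have "B \<subseteq> {0<..}" using B False by (force simp: order_le_less)
    then show ?thesis using B by blast
  qed
  then have [measurable]: "B \<in> sets borel" by auto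
  have K_int: "(LINT t|K n. f t) = (LINT v|L n. (x n / (1 + (x n * v)\<^sup>2) / ?D n) *\<^sub>R f (x n * v))"
    if n: "n \<ge> N" and [measurable]: "f \<in> borel_measurable borel" for n and f :: "real \<Rightarrow> 'a :: {banach, second_countable_topology}"
  proof -
    note [measurable_cong] = sets[of n]
    have "(LINT t|K n. f t) = (LINT t|distr (L n) borel (\<lambda>v. x n * v). (x n / (1 + t\<^sup>2) / ?D n) *\<^sub>R f t)"
      unfolding K_def using N[OF n] by (intro integral_density) (auto simp: add_pos_nonneg intro!: divide_nonneg_nonneg)
    also have "\<dots> = (LINT v|L n. (x n / (1 + (x n * v)\<^sup>2) / ?D n) *\<^sub>R f (x n * v))"
      by (rule integral_distr) auto
    finally show ?thesis .
  qed
  have K_dist: "real_distribution (K n)" if n: "n \<ge> N" for n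
  proof -
    interpret finite_measure "L n" by fact
    note [measurable_cong] = sets[of n]
    have int: "integrable (L n) (\<lambda>v. x n / (1 + (x n * v)\<^sup>2))"
      using N[OF n] by (intro integrable_const_bound[of _ "x n"])
       (auto simp: divide_simps add_pos_nonneg mult_le_cancel_left1)
    have "emeasure (K n) (space (K n)) = (\<integral>\<^sup>+v. ennreal (x n / (1 + (x n * v)\<^sup>2) / ?D n) \<partial>L n)"
      by (simp add: K_def emeasure_density nn_integral_distr)
    also have "\<dots> = ennreal (LINT v|L n. x n / (1 + (x n * v)\<^sup>2) / ?D n)"
      using N[OF n] by (intro nn_integral_eq_integral integrable_divide int)
        (auto simp: add_pos_nonneg intro!: divide_nonneg_nonneg)
    also have "(LINT v|L n. x n / (1 + (x n * v)\<^sup>2) / ?D n) = 1"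
      using N(1)[OF n] by (subst integral_divide_zero, intro divide_self) simp
    finally have "prob_space (K n)" by (intro prob_spaceI) simp
    then show ?thesis by (simp add: real_distribution_def real_distribution_axioms_def K_def)
  qed
  have weak: "weak_conv_m (\<lambda>n. K (n + N)) cauchy_distribution"
  proof (rule levy_continuity[OF K_dist real_distribution_cauchy])
    fix b :: real
    let ?E = "\<lambda>n. LINT v|L n. of_real (x n / (1 + (x n * v)\<^sup>2)) * iexp (b * (x n * v))"
    have "(\<lambda>n. ?E n / of_real (?D n)) \<longlonglongrightarrow> of_real (sqrt (2 * pi) / 2 * exp (- \<bar>b\<bar>)) / of_real (sqrt (2 * pi) / 2)"
      by (intro tendsto_divide tendsto_of_real D cauchy_weighted_char_limit[OF fin sets x lim C bound r]) simp
    also have "of_real (sqrt (2 * pi) / 2 * exp (- \<bar>b\<bar>)) / of_real (sqrt (2 * pi) / 2) = char cauchy_distribution b"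
      by (simp add: char_cauchy_distribution)
    finally have "(\<lambda>n. ?E (n + N) / of_real (?D (n + N))) \<longlonglongrightarrow> char cauchy_distribution b"
      by (rule LIMSEQ_ignore_initial_segment)
    moreover have "char (K (n + N)) b = ?E (n + N) / of_real (?D (n + N))" for n
      unfolding char_def by (subst K_int) (auto simp: scaleR_conv_of_real simp flip: integral_divide_zero intro!: Bochner_Integration.integral_cong)
    ultimately show "(\<lambda>n. char (K (n + N)) b) \<longlonglongrightarrow> char cauchy_distribution b" by simp
  qed simp
  \<comment> \<open>The factor \<open>1 + t\<^sup>2\<close> undoes the Cauchy weight. The function
    stays bounded because \<open>B\<close> lies in the nonnegative half-line, and its only possible
    discontinuity is at 0, a Cauchy null set.\<close>
  define f where "f t = exp (- t) * (1 + t\<^sup>2) * indicator B t" for t :: real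
  have [measurable]: "f \<in> borel_measurable borel" unfolding f_def by measurable
  have "(\<lambda>n. LINT t|K (n + N). f t) \<longlonglongrightarrow> (LINT t|cauchy_distribution. f t)"
  proof (rule weak_conv_imp_bdd_ae_continuous_conv[OF K_dist real_distribution_cauchy weak, where B = 2])
    have cont: "isCont f t" if "t \<noteq> 0" for t
    proof -
      have "isCont (indicator B :: real \<Rightarrow> real) t"
        using B' that by (subst isCont_indicator) (auto simp: frontier_def interior_open)
      then show ?thesis unfolding f_def by (intro continuous_intros)
    qed
    have "{t. \<not> isCont f t} \<subseteq> {0}" using cont by auto
    then have disj: "{t. \<not> isCont f t} = {} \<or> {t. \<not> isCont f t} = {0}" by (rule subset_singletonD)
    have null:  "emeasure cauchy_distribution {0} = 0"
      unfolding cauchy_distribution_def by (subst emeasure_density) (auto intro!: nn_integral_0_iff_AE[THEN iffD2] AE_I2)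
    from disj show "emeasure cauchy_distribution {t. \<not> isCont f t} = 0"
    proof
      assume e: "{t. \<not> isCont f t} = {}"
      show ?thesis unfolding e by simp
    next
      assume e: "{t. \<not> isCont f t} = {0}"
      show ?thesis unfolding e by (rule null)
    qed
    show "norm (f t) \<le> 2" for t
    proof (cases "t \<ge> 0")
      case True
      \<comment> \<open>From \<open>exp t \<ge> 1 + t + t\<^sup>2 / 2\<close> for nonnegative
        \<open>t\<close>.\<close>
      have "1 + t\<^sup>2 \<le> 2 * exp t" using exp_lower_Taylor_quadratic[OF True] True by auto
      then have "exp (- t) * (1 + t\<^sup>2) \<le> exp (- t) * (2 * exp t)" by (intro mult_left_mono) auto
      also have "\<dots> = 2" by (simp flip: exp_add)
      finally show ?thesis by (auto simp: f_def indicator_def)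
    next
      case False
      then show ?thesis using B by (auto simp: f_def indicator_def)
    qed
  qed auto
  moreover have "(LINT t|cauchy_distribution. f t) = 1 / pi"
  proof -
    have "(LINT t|cauchy_distribution. f t) = (LINT t|lborel. (1 / pi) * (exp (- t) * indicator {0..} t))"
      unfolding integral_cauchy_distribution[OF \<open>f \<in> borel_measurable borel\<close>]
    proof (rule integral_cong_AE)
      show "AE t in lborel. (1 / (pi * (1 + t\<^sup>2))) *\<^sub>R f t = (1 / pi) * (exp (- t) * indicator {0..} t)"
        using AE_lborel_singleton[of 0]
      proof eventually_elim
        case (elim t)
        have "1 + t\<^sup>2 \<noteq> 0" by (simp add: add_nonneg_eq_0_iff)
        then show ?case using B' elim by (auto simp: f_def indicator_def)
      qed
    qed auto
    also have "\<dots> = 1 / pi" unfolding integral_mult_right_zero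
      using has_bochner_integral_I0i_power_exp_m'[of 0] by (simp add: has_bochner_integral_iff)
    finally show ?thesis .
  qed
  moreover have "(LINT t|K n. f t) = x n * (LINT v|L n. exp (- (x n * v)) * indicator B v) / ?D n" if n: "n \<ge> N" for n
  proof -
    have "(LINT t|K n. f t) = (LINT v|L n. x n * (exp (- (x n * v)) * indicator B v) / ?D n)"
      unfolding K_int[OF n \<open>f \<in> borel_measurable borel\<close>]
    proof (rule Bochner_Integration.integral_cong[OF refl])
      fix v
      have "1 + (x n * v)\<^sup>2 \<noteq> 0" by (simp add: add_nonneg_eq_0_iff)
      moreover have "indicator B (x n * v) = (indicator B v :: real)"
        using B' N(2)[OF n] by (auto simp: indicator_def zero_less_mult_iff zero_le_mult_iff)
      ultimately show "(x n / (1 + (x n * v)\<^sup>2) / ?D n) *\<^sub>R f (x n * v) = x n * (exp (- (x n * v)) * indicator B v) / ?D n"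
        by (simp add: f_def)
    qed
    then show ?thesis by simp
  qed
  ultimately have "(\<lambda>n. x (n + N) * (LINT v|L (n + N). exp (- (x (n + N) * v)) * indicator B v) / ?D (n + N)) \<longlonglongrightarrow> 1 / pi"
    by simp
  then have "(\<lambda>n. x n * (LINT v|L n. exp (- (x n * v)) * indicator B v) / ?D n) \<longlonglongrightarrow> 1 / pi"
    by (rule LIMSEQ_offset)
  from tendsto_mult[OF this D]
  have "(\<lambda>n. x n * (LINT v|L n. exp (- (x n * v)) * indicator B v) / ?D n * ?D n) \<longlonglongrightarrow> 1 / pi * (sqrt (2 * pi) / 2)" .
  then have "(\<lambda>n. x n * (LINT v|L n. exp (- (x n * v)) * indicator B v)) \<longlonglongrightarrow> 1 / pi * (sqrt (2 * pi) / 2)"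
  proof (rule Lim_transform_eventually)
    show "\<forall>\<^sub>F n in sequentially. x n * (LINT v|L n. exp (- (x n * v)) * indicator B v) / ?D n * ?D n
       = x n * (LINT v|L n. exp (- (x n * v)) * indicator B v)"
      using eventually_ge_at_top[of N]
    proof eventually_elim
      case (elim n)
      from N(1)[OF elim] have "?D n \<noteq> 0" by (rule less_imp_neq[symmetric])
      then show ?case by (rule nonzero_eq_divide_eq[THEN iffD1, OF _ refl])
    qed
  qed
  moreover have "1 / pi * (sqrt (2 * pi) / 2) = 1 / sqrt (2 * pi)" by (simp add: field_simps)
  ultimately show ?thesis by (simp only:)
qed

section \<open>Truncated exponential moments\<close>

text \<open>\<open>D\<close> will be the law of a standardised observation or of its negative. With
  exponent \<open>\<kappa> = 4 * \<gamma> / (2 * \<gamma> + 1)\<close> the Linnik condition takes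
  the form \<open>subexp\<close>, and 1/6 < \<gamma> \<le> 1/4 places \<open>\<kappa>\<close>
  between 1/2 and 2/3. Since the variance is one, \<open>g\<close> is the skewness of
  \<open>D\<close>.\<close>

locale subexponential_law = D: real_distribution D for D :: "real measure" +
  fixes c \<kappa> g :: real
  assumes c: "c > 0" and kappa: "1 / 2 \<le> \<kappa>" "\<kappa> < 1"
    and subexp: "integrable D (\<lambda>y. exp (c * \<bar>y\<bar> powr \<kappa>))"
    and mean: "(LINT y|D. y) = 0" and second: "(LINT y|D. y\<^sup>2) = 1" and third: "(LINT y|D. y ^ 3) = g"
begin

text \<open>Half of the exponent in \<open>subexp\<close> absorbs any power:
  \<open>\<kappa> \<ge> 1 / 2\<close> bounds \<open>\<bar>y\<bar> ^ k\<close> by one plus the power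
  \<open>2 * k\<close> of \<open>\<bar>y\<bar> powr \<kappa>\<close>, and a power of the exponent is
  at most a constant times its exponential.\<close>

lemma integrable_moment_subexp: "integrable D (\<lambda>y. \<bar>y\<bar> ^ k * exp (c / 2 * \<bar>y\<bar> powr \<kappa>))"
proof (rule Bochner_Integration.integrable_bound)
  let ?K = "1 + (2 / c) ^ (2 * k) * fact (2 * k)"
  show "integrable D (\<lambda>y. ?K * exp (c * \<bar>y\<bar> powr \<kappa>))"
    by (intro integrable_mult_right subexp)
  show "AE y in D. norm (\<bar>y\<bar> ^ k * exp (c / 2 * \<bar>y\<bar> powr \<kappa>)) \<le> norm (?K * exp (c * \<bar>y\<bar> powr \<kappa>))"
  proof (rule AE_I2)
    fix y
    define q where "q = c / 2 * \<bar>y\<bar> powr \<kappa>"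
    have q: "q \<ge> 0" using c by (simp add: q_def)
    have "\<bar>y\<bar> ^ k \<le> 1 + (\<bar>y\<bar> powr \<kappa>) ^ (2 * k)"
    proof (cases "\<bar>y\<bar> \<ge> 1")
      case True
      have "\<bar>y\<bar> ^ k = \<bar>y\<bar> powr real k" using True by (simp add: powr_realpow)
      also have "\<dots> \<le> \<bar>y\<bar> powr (\<kappa> * real (2 * k))"
      proof (rule powr_mono[OF _ True])
        have "1 / 2 * real (2 * k) \<le> \<kappa> * real (2 * k)" using kappa by (intro mult_right_mono) auto
        then show "real k \<le> \<kappa> * real (2 * k)" by simp
      qed
      also have "\<dots> = (\<bar>y\<bar> powr \<kappa>) powr real (2 * k)" by (simp add: powr_powr)
      also have "\<dots> = (\<bar>y\<bar> powr \<kappa>) ^ (2 * k)" using True by (subst powr_realpow) auto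
      finally show ?thesis by simp
    next
      case False
      then have "\<bar>y\<bar> ^ k \<le> 1" by (intro power_le_one) auto
      then show ?thesis by (smt (verit) zero_le_power powr_ge_zero)
    qed
    also have "\<bar>y\<bar> powr \<kappa> = 2 / c * q" using c by (simp add: q_def)
    also have "(2 / c * q) ^ (2 * k) \<le> (2 / c) ^ (2 * k) * (fact (2 * k) * exp q)"
      unfolding power_mult_distrib using power_le_fact_mult_exp[OF q, of "2 * k"] c by (intro mult_left_mono) auto
    also have "1 + (2 / c) ^ (2 * k) * (fact (2 * k) * exp q) \<le> ?K * exp q"
      using q by (simp add: algebra_simps)
    finally have "\<bar>y\<bar> ^ k * exp q \<le> ?K * exp q * exp q" by (intro mult_right_mono) auto
    also have "\<dots> = ?K * exp (c * \<bar>y\<bar> powr \<kappa>)" by (simp add: q_def mult.assoc flip: exp_add)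
    finally show "norm (\<bar>y\<bar> ^ k * exp (c / 2 * \<bar>y\<bar> powr \<kappa>)) \<le> norm (?K * exp (c * \<bar>y\<bar> powr \<kappa>))"
      by (simp add: q_def)
  qed
qed (use D.events_eq_borel in measurable)

lemma integrable_abs_moment: "integrable D (\<lambda>y. \<bar>y\<bar> ^ k)"
proof (rule Bochner_Integration.integrable_bound[OF integrable_moment_subexp[of k]])
  show "AE y in D. norm (\<bar>y\<bar> ^ k) \<le> norm (\<bar>y\<bar> ^ k * exp (c / 2 * \<bar>y\<bar> powr \<kappa>))"
    using c by (intro AE_I2) (simp add: abs_mult mult_le_cancel_left1)
qed measurable

lemma integrable_moment: "integrable D (\<lambda>y. y ^ k)"
  by (rule Bochner_Integration.integrable_bound[OF integrable_abs_moment[of k]]) (auto simp: power_abs)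

text \<open>The argument is complex so that tilting (real part) and the Fourier variable (imaginary
  part) are handled by one expansion. Truncation is essential: for \<open>\<kappa> < 1\<close> the
  full moment generating function may be infinite.\<close>

definition trunc_mgf :: "real \<Rightarrow> complex \<Rightarrow> complex" where
  "trunc_mgf T z = (LINT y|D. indicator {-T..T} y *\<^sub>R exp (z * of_real y))"

text \<open>The first summand bounds the Taylor remainder of order four inside the truncation
  interval, the second the cubic Taylor polynomial outside it.\<close>

definition rem_const :: real where
  "rem_const = (LINT y|D. \<bar>y\<bar> ^ 4 * exp (c / 2 * \<bar>y\<bar> powr \<kappa>)) + 4 * (LINT y|D. \<bar>y\<bar> ^ 7)"

lemma rem_const_nonneg: "rem_const \<ge> 0"
  unfolding rem_const_def by (intro add_nonneg_nonneg mult_nonneg_nonneg integral_nonneg_AE AE_I2) auto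

lemma integrable_trunc_exp: "complex_integrable D (\<lambda>y. indicator {-T..T} y *\<^sub>R exp (z * of_real y))"
proof (rule D.integrable_const_bound[of _ "exp (norm z * \<bar>T\<bar>)"])
  show "AE y in D. norm (indicator {-T..T} y *\<^sub>R exp (z * complex_of_real y)) \<le> exp (norm z * \<bar>T\<bar>)"
  proof (rule AE_I2)
    fix y
    have "Re z * y \<le> norm z * \<bar>T\<bar>" if "y \<in> {-T..T}"
    proof -
      have "Re z * y \<le> \<bar>Re z\<bar> * \<bar>y\<bar>" by (metis abs_ge_self abs_mult)
      also have "\<dots> \<le> norm z * \<bar>T\<bar>" using that by (intro mult_mono abs_Re_le_cmod) auto
      finally show ?thesis .
    qed
    then show "norm (indicator {-T..T} y *\<^sub>R exp (z * complex_of_real y)) \<le> exp (norm z * \<bar>T\<bar>)"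
      by (auto simp: indicator_def)
  qed
qed measurable

text \<open>The moments 0, 1, 1 and \<open>g\<close> of orders 1 to 3, with the order zero term,
  integrate the cubic Taylor polynomial to the stated one. Inside \<open>[-T, T]\<close> the
  hypothesis \<open>hT\<close> keeps the growth of the exponential below
  \<open>exp (c / 2 * \<bar>y\<bar> powr \<kappa>)\<close>, which is integrable against any power;
  outside, only the polynomial is left.\<close>

lemma trunc_mgf_expansion:
  assumes h: "Re z \<ge> 0" and T: "T \<ge> 1" and hT: "Re z * T powr (1 - \<kappa>) \<le> c / 2" and z: "norm z \<le> 1"
  shows "norm (trunc_mgf T z - (1 + z\<^sup>2 / 2 + of_real g * z ^ 3 / 6)) \<le> rem_const * norm z ^ 4 + rem_const / T ^ 4"
proof -
  define p where "p = (\<lambda>y. 1 + of_real y * z + of_real (y\<^sup>2) * (z\<^sup>2 / 2) + of_real (y ^ 3) * (z ^ 3 / 6))"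
  let ?e = "\<lambda>y. exp (c / 2 * \<bar>y\<bar> powr \<kappa>)"
  have [simp]: "integrable D (\<lambda>y. y)" "integrable D (\<lambda>y. y\<^sup>2)" "integrable D (\<lambda>y. y ^ 3)"
    using integrable_moment[of 1] integrable_moment[of 2] integrable_moment[of 3] by simp_all
  have pint: "complex_integrable D p"
    unfolding p_def by (intro Bochner_Integration.integrable_add integrable_mult_left integrable_of_real) simp_all
  have "(LINT y|D. p y) = 1 + z\<^sup>2 / 2 + of_real g * z ^ 3 / 6"
  proof -
    have 1: "complex_integrable D (\<lambda>y. of_real y * z)" "complex_integrable D (\<lambda>y. of_real (y\<^sup>2) * (z\<^sup>2 / 2))"
      "complex_integrable D (\<lambda>y. of_real (y ^ 3) * (z ^ 3 / 6))" "complex_integrable D (\<lambda>y. 1)"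
      by (intro integrable_mult_left integrable_of_real D.integrable_const; simp)+
    note 2 = Bochner_Integration.integrable_add[OF 1(4) 1(1)]
      Bochner_Integration.integrable_add[OF Bochner_Integration.integrable_add[OF 1(4) 1(1)] 1(2)]
    show ?thesis unfolding p_def
      unfolding Bochner_Integration.integral_add[OF 2(2) 1(3)] Bochner_Integration.integral_add[OF 2(1) 1(2)]
        Bochner_Integration.integral_add[OF 1(4) 1(1)] integral_mult_left_zero integral_complex_of_real mean second third
      using D.prob_space by simp
  qed
  then have "trunc_mgf T z - (1 + z\<^sup>2 / 2 + of_real g * z ^ 3 / 6) = (LINT y|D. indicator {-T..T} y *\<^sub>R exp (z * of_real y) - p y)"
    unfolding trunc_mgf_def by (simp add: Bochner_Integration.integral_diff[OF integrable_trunc_exp pint])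
  also have "norm \<dots> \<le> (LINT y|D. norm z ^ 4 * (\<bar>y\<bar> ^ 4 * ?e y) + 4 / T ^ 4 * \<bar>y\<bar> ^ 7)"
  proof (rule Bochner_Integration.integral_norm_bound_integral)
    show "complex_integrable D (\<lambda>y. indicator {-T..T} y *\<^sub>R exp (z * of_real y) - p y)"
      by (intro Bochner_Integration.integrable_diff integrable_trunc_exp pint)
    show "integrable D (\<lambda>y. norm z ^ 4 * (\<bar>y\<bar> ^ 4 * ?e y) + 4 / T ^ 4 * \<bar>y\<bar> ^ 7)"
      by (intro Bochner_Integration.integrable_add integrable_mult_right integrable_moment_subexp integrable_abs_moment)
    fix y
    have p: "p y = (\<Sum>k\<le>3. (z * of_real y) ^ k / fact k)"
      by (simp add: p_def numeral_3_eq_3 power_mult_distrib fact_numeral mult_ac power2_eq_square)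
    show "norm (indicator {-T..T} y *\<^sub>R exp (z * of_real y) - p y) \<le> norm z ^ 4 * (\<bar>y\<bar> ^ 4 * ?e y) + 4 / T ^ 4 * \<bar>y\<bar> ^ 7"
    proof (cases "y \<in> {-T..T}")
      case True
      \<comment> \<open>Split \<open>\<bar>y\<bar>\<close> as
        \<open>\<bar>y\<bar> powr \<kappa>\<close> times
        \<open>\<bar>y\<bar> powr (1 - \<kappa>)\<close> and bound the second factor by its value at
        \<open>T\<close>.\<close>
      have "\<bar>Re (z * of_real y)\<bar> \<le> c / 2 * \<bar>y\<bar> powr \<kappa>"
      proof (cases "y = 0")
        case False
        have "\<bar>y\<bar> = \<bar>y\<bar> powr \<kappa> * \<bar>y\<bar> powr (1 - \<kappa>)" using False by (simp flip: powr_add)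
        also have "\<dots> \<le> \<bar>y\<bar> powr \<kappa> * T powr (1 - \<kappa>)"
          using True kappa by (intro mult_left_mono powr_mono2) auto
        finally have "Re z * \<bar>y\<bar> \<le> Re z * (\<bar>y\<bar> powr \<kappa> * T powr (1 - \<kappa>))" using h by (intro mult_left_mono)
        also have "\<dots> = (Re z * T powr (1 - \<kappa>)) * \<bar>y\<bar> powr \<kappa>" by simp
        also have "\<dots> \<le> c / 2 * \<bar>y\<bar> powr \<kappa>" using hT by (intro mult_right_mono) auto
        finally show ?thesis using h by (simp add: abs_mult)
      qed simp
      then have "exp \<bar>Re (z * of_real y)\<bar> \<le> ?e y" by simp
      moreover have "norm (exp (z * of_real y) - p y) \<le> exp \<bar>Re (z * of_real y)\<bar> * norm (z * of_real y) ^ Suc 3 / fact 3"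
        unfolding p by (rule Taylor_exp)
      moreover have "exp \<bar>Re (z * of_real y)\<bar> * norm (z * of_real y) ^ Suc 3 / fact 3 \<le> exp \<bar>Re (z * of_real y)\<bar> * norm (z * of_real y) ^ Suc 3 / 1"
        by (intro divide_left_mono) (auto simp: fact_numeral)
      moreover have "exp \<bar>Re (z * of_real y)\<bar> * norm (z * of_real y) ^ Suc 3 \<le> ?e y * norm (z * of_real y) ^ Suc 3"
        using \<open>exp \<bar>Re (z * of_real y)\<bar> \<le> ?e y\<close> by (intro mult_right_mono) auto
      ultimately have "norm (exp (z * of_real y) - p y) \<le> ?e y * norm (z * of_real y) ^ Suc 3" by linarith
      also have "\<dots> = norm z ^ 4 * (\<bar>y\<bar> ^ 4 * ?e y)" by (simp add: norm_mult power_mult_distrib eval_nat_numeral)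
      finally have "norm (exp (z * of_real y) - p y) \<le> norm z ^ 4 * (\<bar>y\<bar> ^ 4 * ?e y)" .
      moreover have "0 \<le> 4 / T ^ 4 * \<bar>y\<bar> ^ 7" using T by simp
      ultimately have "norm (exp (z * of_real y) - p y) \<le> norm z ^ 4 * (\<bar>y\<bar> ^ 4 * ?e y) + 4 / T ^ 4 * \<bar>y\<bar> ^ 7"
        by linarith
      then show ?thesis using True by simp
    next
      case False
      then have y: "\<bar>y\<bar> \<ge> T" "\<bar>y\<bar> \<ge> 1" using T by auto
      \<comment> \<open>Here the exponential is cut off and the error is \<open>p y\<close> alone.
        Each of its four terms is at most \<open>\<bar>y\<bar> ^ 3\<close>, which
        \<open>\<bar>y\<bar> \<ge> T\<close> converts into
        \<open>\<bar>y\<bar> ^ 7 / T ^ 4\<close>.\<close>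
      have "norm (p y) \<le> (\<Sum>k\<le>3. norm ((z * of_real y) ^ k / fact k))"
        unfolding p by (rule norm_sum)
      also have "\<dots> \<le> (\<Sum>k\<le>(3::nat). \<bar>y\<bar> ^ 3)"
      proof (rule sum_mono)
        fix k :: nat assume "k \<in> {..3}"
        have "norm ((z * of_real y) ^ k / fact k) = (norm z * \<bar>y\<bar>) ^ k / fact k"
          by (simp add: norm_divide norm_power norm_mult)
        also have "\<dots> \<le> (norm z * \<bar>y\<bar>) ^ k / 1" by (intro divide_left_mono) (auto simp: fact_ge_1)
        also have "\<dots> \<le> (1 * \<bar>y\<bar>) ^ k / 1" using z by (intro divide_right_mono power_mono mult_right_mono) auto
        also have "\<dots> \<le> \<bar>y\<bar> ^ 3" using y \<open>k \<in> {..3}\<close> by (simp add: power_increasing)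
        finally show "norm ((z * of_real y) ^ k / fact k) \<le> \<bar>y\<bar> ^ 3" .
      qed
      also have "\<dots> = 4 * \<bar>y\<bar> ^ 3" by simp
      also have "\<dots> = 4 / T ^ 4 * (\<bar>y\<bar> ^ 3 * T ^ 4)" using T by simp
      also have "\<dots> \<le> 4 / T ^ 4 * (\<bar>y\<bar> ^ 3 * \<bar>y\<bar> ^ 4)" using T y by (intro mult_left_mono power_mono) auto
      also have "\<dots> = 4 / T ^ 4 * \<bar>y\<bar> ^ 7" by (simp only: power_add[symmetric]) simp
      finally have "norm (p y) \<le> 4 / T ^ 4 * \<bar>y\<bar> ^ 7" .
      moreover have "0 \<le> norm z ^ 4 * (\<bar>y\<bar> ^ 4 * ?e y)" by simp
      ultimately have "norm (p y) \<le> norm z ^ 4 * (\<bar>y\<bar> ^ 4 * ?e y) + 4 / T ^ 4 * \<bar>y\<bar> ^ 7"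
        by linarith
      then show ?thesis using False by simp
    qed
  qed
  also have "\<dots> = norm z ^ 4 * (LINT y|D. \<bar>y\<bar> ^ 4 * ?e y) + 4 / T ^ 4 * (LINT y|D. \<bar>y\<bar> ^ 7)"
    by (simp only: integral_mult_right_zero Bochner_Integration.integral_add[OF
        integrable_mult_right[OF integrable_moment_subexp] integrable_mult_right[OF integrable_abs_moment]])
  also have "\<dots> \<le> rem_const * norm z ^ 4 + rem_const / T ^ 4"
  proof -
    have "(LINT y|D. \<bar>y\<bar> ^ 4 * ?e y) \<ge> 0" "(LINT y|D. \<bar>y\<bar> ^ 7) \<ge> 0"
      by (intro integral_nonneg_AE AE_I2; simp)+
    then have "norm z ^ 4 * (LINT y|D. \<bar>y\<bar> ^ 4 * ?e y) \<le> norm z ^ 4 * rem_const"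
       "1 / T ^ 4 * (4 * (LINT y|D. \<bar>y\<bar> ^ 7)) \<le> 1 / T ^ 4 * rem_const"
      unfolding rem_const_def using T by (intro mult_left_mono; simp)+
    then show ?thesis by (simp add: mult.commute)
  qed
  finally show ?thesis .
qed

end

section \<open>Exponential tilting\<close>

text \<open>With truncation point \<open>T = sqrt n * x n\<close> and tilt
  \<open>h = x n / sqrt n\<close>, the quantity in \<open>x_trunc\<close> equals
  \<open>h * T powr (1 - \<kappa>)\<close>. Its smallness therefore supplies the hypothesis of
  \<open>trunc_mgf_expansion\<close> and also makes the tail beyond \<open>T\<close> negligible
  against \<open>exp (- (x n)\<^sup>2 / 2)\<close>.\<close>

locale moderate_deviation = subexponential_law +
  fixes x :: "nat \<Rightarrow> real"
  assumes x_top: "filterlim x at_top sequentially"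
    and x_sq: "(\<lambda>n. (x n)\<^sup>2 / sqrt (real n)) \<longlonglongrightarrow> 0"
    and x_trunc: "(\<lambda>n. (x n)\<^sup>2 / (sqrt (real n) * x n) powr \<kappa>) \<longlonglongrightarrow> 0"
begin

definition level :: "nat \<Rightarrow> real" where
  "level n = x n + g / (6 * sqrt (real n)) * (x n)\<^sup>2"

definition trunc :: "nat \<Rightarrow> real" where
  "trunc n = sqrt (real n) * x n"

definition tilt_point :: "nat \<Rightarrow> real \<Rightarrow> complex" where
  "tilt_point n \<eta> = Complex (x n) \<eta> / of_real (sqrt (real n))"

text \<open>The closed form of the characteristic function of \<open>tilted_law\<close>, as
  \<open>char_tilted_law\<close> shows. Stating it through \<open>trunc_mgf\<close> lets the
  analysis precede any choice of sample space.\<close>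

definition tilted_char :: "nat \<Rightarrow> real \<Rightarrow> complex" where
  "tilted_char n \<eta> = of_real (exp ((x n)\<^sup>2 / 2)) * trunc_mgf (trunc n) (tilt_point n \<eta>) ^ n
     * exp (- Complex (x n) \<eta> * of_real (level n))"

lemma x_ge: "\<forall>\<^sub>F n in sequentially. x n \<ge> a"
  using x_top by (auto simp: filterlim_at_top)

lemma x_over_sqrt: "(\<lambda>n. x n / sqrt (real n)) \<longlonglongrightarrow> 0"
proof (rule Lim_null_comparison[OF _ x_sq])
  show "\<forall>\<^sub>F n in sequentially. norm (x n / sqrt (real n)) \<le> (x n)\<^sup>2 / sqrt (real n)"
    using x_ge[of 1]
  proof eventually_elim
    case (elim n)
    then have "x n \<le> x n * x n" by (simp add: mult_le_cancel_left1)
    then show ?case using elim by (simp add: divide_right_mono power2_eq_square)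
  qed
qed

lemma inverse_sqrt: "(\<lambda>n. 1 / sqrt (real n)) \<longlonglongrightarrow> 0"
  by real_asymp

text \<open>This controls the term \<open>rem_const / T ^ 4\<close> of the expansion after
  multiplication by \<open>n\<close>: eventually \<open>trunc n ^ 4 \<ge> n\<^sup>2\<close>.\<close>

lemma trunc_small: "(\<lambda>n. real n / trunc n ^ 4) \<longlonglongrightarrow> 0"
proof (rule Lim_null_comparison)
  show "(\<lambda>n. 1 / real n) \<longlonglongrightarrow> 0" by real_asymp
  show "\<forall>\<^sub>F n in sequentially. norm (real n / trunc n ^ 4) \<le> 1 / real n"
    using x_ge[of 1] eventually_gt_at_top[of 0]
  proof eventually_elim
    case (elim n)
    have "sqrt (real n) ^ 4 = real n * real n"
      by (simp add: power4_eq_xxxx)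
    moreover have "1 \<le> x n ^ 4" using elim by simp
    ultimately show ?case using elim
      by (auto simp: trunc_def power_mult_distrib divide_simps mult_le_cancel_left1)
  qed
qed

lemma tilt_point_sq: "tilt_point n \<eta> ^ 2 * of_nat n = Complex (x n) \<eta> ^ 2" if "n > 0"
proof -
  have "complex_of_real (sqrt (real n)) ^ 2 = of_nat n" by (simp flip: of_real_power)
  then show ?thesis using that by (simp add: tilt_point_def power_divide)
qed

lemma norm_tilt_point_4: "real n * norm (tilt_point n \<eta>) ^ 4 = ((x n)\<^sup>2 + \<eta>\<^sup>2)\<^sup>2 / real n" if "n > 0"
proof -
  have "norm (tilt_point n \<eta>) ^ 2 = ((x n)\<^sup>2 + \<eta>\<^sup>2) / real n"
    by (simp add: tilt_point_def norm_divide power_divide cmod_power2)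
  moreover have "norm (tilt_point n \<eta>) ^ 4 = (norm (tilt_point n \<eta>) ^ 2) ^ 2" by (simp flip: power_mult)
  ultimately show ?thesis using that by (simp add: power_divide power2_eq_square)
qed

text \<open>The point is uniformity: a single threshold for \<open>n\<close> serves all
  \<open>\<eta>\<close> in the range. The two halves \<open>x n / sqrt n < 1 / 2\<close> and
  \<open>\<bar>\<eta>\<bar> / sqrt n \<le> 1 / 2\<close> keep the argument in the unit disc.\<close>

lemma trunc_mgf_eventually:
  "\<forall>\<^sub>F n in sequentially. \<forall>\<eta>. \<bar>\<eta>\<bar> \<le> sqrt (real n) / 2 \<longrightarrow> norm (tilt_point n \<eta>) \<le> 1 \<and>
     norm (trunc_mgf (trunc n) (tilt_point n \<eta>) - (1 + (tilt_point n \<eta>)\<^sup>2 / 2 + of_real g * tilt_point n \<eta> ^ 3 / 6))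
       \<le> rem_const * norm (tilt_point n \<eta>) ^ 4 + rem_const / trunc n ^ 4"
proof -
  have "\<forall>\<^sub>F n in sequentially. x n / sqrt (real n) < 1 / 2"
    using x_over_sqrt by (rule order_tendstoD) simp
  moreover have "\<forall>\<^sub>F n in sequentially. (x n)\<^sup>2 / (sqrt (real n) * x n) powr \<kappa> < c / 2"
    using x_trunc by (rule order_tendstoD) (use c in simp)
  ultimately show ?thesis using x_ge[of 1] eventually_gt_at_top[of 0]
  proof eventually_elim
    case (elim n)
    have s: "sqrt (real n) \<ge> 1" using elim by simp
    have T: "trunc n \<ge> 1" using mult_mono[OF s elim(3)] by (simp add: trunc_def)
    have Re: "Re (tilt_point n \<eta>) = x n / sqrt (real n)" for \<eta>
      by (simp add: tilt_point_def)
    have "x n / sqrt (real n) * trunc n powr (1 - \<kappa>) = x n / sqrt (real n) * (trunc n / trunc n powr \<kappa>)"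
      using T by (simp add: powr_diff)
    also have "\<dots> = (x n)\<^sup>2 / (sqrt (real n) * x n) powr \<kappa>"
      using elim by (simp add: trunc_def power2_eq_square)
    finally have hT: "x n / sqrt (real n) * trunc n powr (1 - \<kappa>) \<le> c / 2" using elim by simp
    show ?case
    proof (intro allI impI conjI)
      fix \<eta> assume \<eta>: "\<bar>\<eta>\<bar> \<le> sqrt (real n) / 2"
      have "norm (tilt_point n \<eta>) \<le> (\<bar>x n\<bar> + \<bar>\<eta>\<bar>) / sqrt (real n)"
        using cmod_le[of "Complex (x n) \<eta>"] by (simp add: tilt_point_def norm_divide divide_right_mono)
      also have "\<dots> = x n / sqrt (real n) + \<bar>\<eta>\<bar> / sqrt (real n)" using elim by (simp add: add_divide_distrib)
      also have "\<bar>\<eta>\<bar> / sqrt (real n) \<le> 1 / 2" using \<eta> s by (simp add: divide_simps)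
      finally show n1: "norm (tilt_point n \<eta>) \<le> 1" using elim by linarith
      show "norm (trunc_mgf (trunc n) (tilt_point n \<eta>) - (1 + (tilt_point n \<eta>)\<^sup>2 / 2 + of_real g * tilt_point n \<eta> ^ 3 / 6))
       \<le> rem_const * norm (tilt_point n \<eta>) ^ 4 + rem_const / trunc n ^ 4"
        using elim T hT n1 by (intro trunc_mgf_expansion) (auto simp: Re)
    qed
  qed
qed

text \<open>With \<open>Z = x n + \<i> * \<eta>\<close>, taking \<open>n\<close> times the logarithm
  of the truncated generating function gives \<open>Z\<^sup>2 / 2 + g * Z ^ 3 / (6 * sqrt n)\<close>
  up to a vanishing error. Adding \<open>(x n)\<^sup>2 / 2\<close> and subtracting
  \<open>Z * level n\<close> cancels every growing term, including
  \<open>g * x n ^ 3 / (6 * sqrt n)\<close>, which need not tend to zero, and leaves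
  \<open>- \<eta>\<^sup>2 / 2\<close> plus the vanishing \<open>F n\<close>.\<close>

lemma tilted_char_limit: "(\<lambda>n. tilted_char n \<eta>) \<longlonglongrightarrow> of_real (exp (- \<eta>\<^sup>2 / 2))"
proof -
  let ?s = "\<lambda>n. sqrt (real n)"
  let ?z = "\<lambda>n. tilt_point n \<eta>" and ?Z = "\<lambda>n. Complex (x n) \<eta>"
  define w where "w n = trunc_mgf (trunc n) (?z n) - 1" for n
  define R where "R n = w n - ((?z n)\<^sup>2 / 2 + of_real g * ?z n ^ 3 / 6)" for n
  have Z: "?Z n = of_real (x n) + \<i> * of_real \<eta>" for n by (simp add: complex_eq_iff)
  have ev\<eta>: "\<forall>\<^sub>F n in sequentially. \<bar>\<eta>\<bar> \<le> ?s n / 2" by real_asymp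
  have pos: "\<forall>\<^sub>F n in sequentially. n > (0::nat)" by (rule eventually_gt_at_top)
  \<comment> \<open>The quantity is the square of
    \<open>((x n)\<^sup>2 + \<eta>\<^sup>2) / sqrt n\<close>, so it vanishes by \<open>x_sq\<close>;
    it governs all errors below.\<close>
  have norm4: "(\<lambda>n. real n * norm (?z n) ^ 4) \<longlonglongrightarrow> 0"
  proof -
    have "(\<lambda>n. ((x n)\<^sup>2 / ?s n + \<eta>\<^sup>2 * (1 / ?s n))\<^sup>2) \<longlonglongrightarrow> (0 + \<eta>\<^sup>2 * 0)\<^sup>2"
      by (intro tendsto_intros x_sq inverse_sqrt)
    then have "(\<lambda>n. ((x n)\<^sup>2 / ?s n + \<eta>\<^sup>2 * (1 / ?s n))\<^sup>2) \<longlonglongrightarrow> 0" by simp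
    moreover have "\<forall>\<^sub>F n in sequentially. ((x n)\<^sup>2 / ?s n + \<eta>\<^sup>2 * (1 / ?s n))\<^sup>2 = real n * norm (?z n) ^ 4"
      using pos by eventually_elim (simp add: norm_tilt_point_4 power_divide flip: add_divide_distrib)
    ultimately show ?thesis by (rule Lim_transform_eventually)
  qed
  have nR: "(\<lambda>n. of_nat n * R n) \<longlonglongrightarrow> 0"
  proof (rule Lim_null_comparison)
    show "(\<lambda>n. rem_const * (real n * norm (?z n) ^ 4) + rem_const * (real n / trunc n ^ 4)) \<longlonglongrightarrow> 0"
      using tendsto_add[OF tendsto_mult_right_zero[OF norm4, of rem_const] tendsto_mult_right_zero[OF trunc_small, of rem_const]] by simp
    show "\<forall>\<^sub>F n in sequentially. norm (of_nat n * R n) \<le> rem_const * (real n * norm (?z n) ^ 4) + rem_const * (real n / trunc n ^ 4)"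
      using trunc_mgf_eventually ev\<eta>
    proof eventually_elim
      case (elim n)
      then have "norm (R n) \<le> rem_const * norm (?z n) ^ 4 + rem_const / trunc n ^ 4"
        unfolding R_def w_def by (simp add: algebra_simps)
      then have "real n * norm (R n) \<le> real n * (rem_const * norm (?z n) ^ 4 + rem_const / trunc n ^ 4)"
        by (intro mult_left_mono) auto
      then show ?case by (simp add: norm_mult algebra_simps)
    qed
  qed
  have nz: "(\<lambda>n. norm (?z n)) \<longlonglongrightarrow> 0"
  proof (rule Lim_null_comparison)
    show "(\<lambda>n. x n / ?s n + \<bar>\<eta>\<bar> * (1 / ?s n)) \<longlonglongrightarrow> 0"
      using tendsto_add[OF x_over_sqrt tendsto_mult_right_zero[OF inverse_sqrt, of "\<bar>\<eta>\<bar>"]] by simp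
    show "\<forall>\<^sub>F n in sequentially. norm (norm (?z n)) \<le> x n / ?s n + \<bar>\<eta>\<bar> * (1 / ?s n)"
      using x_ge[of 0]
    proof eventually_elim
      case (elim n)
      have "norm (?z n) \<le> (\<bar>x n\<bar> + \<bar>\<eta>\<bar>) / ?s n"
        using cmod_le[of "?Z n"] by (simp add: tilt_point_def norm_divide divide_right_mono)
      then show ?case using elim by (simp add: add_divide_distrib)
    qed
  qed
  have z0: "?z \<longlonglongrightarrow> 0" using nz by (simp add: tendsto_norm_zero_iff)
  have sz2: "(\<lambda>n. of_real (?s n) * (?z n)\<^sup>2) \<longlonglongrightarrow> 0"
  proof (rule tendsto_norm_zero_cancel)
    have "(\<lambda>n. sqrt (real n * norm (?z n) ^ 4)) \<longlonglongrightarrow> sqrt 0" by (intro tendsto_intros norm4)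
    moreover have "sqrt (real n * norm (?z n) ^ 4) = norm (of_real (?s n) * (?z n)\<^sup>2)" for n
    proof -
      have "sqrt (norm (?z n) ^ 4) = norm (?z n) ^ 2"
        by (rule real_sqrt_unique) (simp_all flip: power_mult)
      then show ?thesis by (simp add: real_sqrt_mult norm_mult norm_power)
    qed
    ultimately show "(\<lambda>n. norm (of_real (?s n) * (?z n)\<^sup>2)) \<longlonglongrightarrow> 0" by simp
  qed
  \<comment> \<open>The scale \<open>sqrt n\<close> is what is needed, because linearising
    \<open>Ln (1 + w n)\<close> costs \<open>n * norm (w n) ^ 2\<close>.\<close>
  have sw: "(\<lambda>n. of_real (?s n) * w n) \<longlonglongrightarrow> 0"
  proof -
    have sR: "(\<lambda>n. of_real (?s n) * R n) \<longlonglongrightarrow> 0"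
    proof (rule Lim_null_comparison)
      show "(\<lambda>n. norm (of_nat n * R n)) \<longlonglongrightarrow> 0" using tendsto_norm[OF nR] by simp
      show "\<forall>\<^sub>F n in sequentially. norm (of_real (?s n) * R n) \<le> norm (of_nat n * R n)"
        using pos
      proof eventually_elim
        case (elim n)
        have "?s n \<le> real n" using elim by (intro real_le_lsqrt) (auto simp: power2_eq_square mult_le_cancel_left1)
        then show ?case by (simp add: norm_mult mult_right_mono)
      qed
    qed
    have "(\<lambda>n. of_real (?s n) * R n + (1 / 2) * (of_real (?s n) * (?z n)\<^sup>2)
          + (of_real g / 6) * ((of_real (?s n) * (?z n)\<^sup>2) * ?z n)) \<longlonglongrightarrow> 0 + (1 / 2) * 0 + (of_real g / 6) * (0 * 0)"
      by (intro tendsto_add tendsto_mult sR sz2 z0 tendsto_const)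
    moreover have "of_real (?s n) * R n + (1 / 2) * (of_real (?s n) * (?z n)\<^sup>2)
          + (of_real g / 6) * ((of_real (?s n) * (?z n)\<^sup>2) * ?z n) = of_real (?s n) * w n" for n
      by (simp add: R_def algebra_simps power2_eq_square power3_eq_cube)
    ultimately show ?thesis by simp
  qed
  have nw2: "(\<lambda>n. real n * norm (w n) ^ 2) \<longlonglongrightarrow> 0"
  proof -
    have "(\<lambda>n. norm (of_real (?s n) * w n) ^ 2) \<longlonglongrightarrow> norm (0::complex) ^ 2" by (intro tendsto_intros sw)
    then show ?thesis by (simp add: norm_mult power_mult_distrib)
  qed
  have wsmall: "\<forall>\<^sub>F n in sequentially. norm (w n) < 1 / 2"
  proof -
    have "\<forall>\<^sub>F n in sequentially. real n * norm (w n) ^ 2 < 1 / 4"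
      using nw2 by (rule order_tendstoD) simp
    then show ?thesis using pos
    proof eventually_elim
      case (elim n)
      have "1 * norm (w n) ^ 2 \<le> real n * norm (w n) ^ 2" using elim by (intro mult_right_mono) auto
      then have "norm (w n) ^ 2 < (1 / 2) ^ 2" using elim by (simp add: power2_eq_square)
      then show ?case by (rule power_less_imp_less_base) simp
    qed
  qed
  \<comment> \<open>The total error, over \<open>n\<close> factors, of replacing
    \<open>Ln (1 + w n)\<close> by \<open>w n\<close>.\<close>
  define E where "E n = of_nat n * (Ln (1 + w n) - w n)" for n
  have E: "E \<longlonglongrightarrow> 0"
  proof (rule Lim_null_comparison)
    show "(\<lambda>n. 2 * (real n * norm (w n) ^ 2)) \<longlonglongrightarrow> 0" using tendsto_mult_right_zero[OF nw2] .
    show "\<forall>\<^sub>F n in sequentially. norm (E n) \<le> 2 * (real n * norm (w n) ^ 2)"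
      using wsmall
    proof eventually_elim
      case (elim n)
      have "norm (Ln (1 + w n) - w n) \<le> norm (w n) ^ 2 / (1 - norm (w n))"
        using elim by (intro Ln_approx_linear) simp
      also have "\<dots> \<le> norm (w n) ^ 2 / (1 / 2)"
        using elim by (intro divide_left_mono) auto
      finally have "real n * norm (Ln (1 + w n) - w n) \<le> real n * (2 * norm (w n) ^ 2)"
        by (intro mult_left_mono) auto
      then show ?case by (simp add: E_def norm_mult)
    qed
  qed
  \<comment> \<open>What survives of the skewness terms after the cancellation: each summand carries
    a factor \<open>\<eta>\<close>, so at most two powers of \<open>x n\<close> remain over
    \<open>sqrt n\<close>.\<close>
  define F where "F n = of_real (g / 6) * (\<i> * of_real \<eta>) * (of_real (2 * ((x n)\<^sup>2 / ?s n)) + 3 * \<i> * of_real \<eta> * of_real (x n / ?s n) - of_real (\<eta>\<^sup>2 * (1 / ?s n)))" for n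
  have F: "F \<longlonglongrightarrow> 0"
  proof -
    have "F \<longlonglongrightarrow> of_real (g / 6) * (\<i> * of_real \<eta>) * (of_real (2 * 0) + 3 * \<i> * of_real \<eta> * of_real 0 - of_real (\<eta>\<^sup>2 * 0))"
      unfolding F_def by (intro tendsto_intros x_sq x_over_sqrt inverse_sqrt)
    then show ?thesis by simp
  qed
  have "(\<lambda>n. exp (of_real (- \<eta>\<^sup>2 / 2) + F n + (of_nat n * R n + E n))) \<longlonglongrightarrow> exp (of_real (- \<eta>\<^sup>2 / 2) + 0 + (0 + 0))"
    by (intro tendsto_intros F nR E)
  moreover have "\<forall>\<^sub>F n in sequentially. exp (of_real (- \<eta>\<^sup>2 / 2) + F n + (of_nat n * R n + E n)) = tilted_char n \<eta>"
    using wsmall pos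
  proof eventually_elim
    case (elim n)
    define s where "s = complex_of_real (?s n)"
    have s2: "s * s = of_nat n" by (simp add: s_def flip: of_real_mult)
    have s0: "s \<noteq> 0" using elim by (simp add: s_def)
    have "1 + w n \<noteq> 0"
    proof
      assume "1 + w n = 0"
      then have "w n = -1" by (simp add: add_eq_0_iff)
      then show False using elim by simp
    qed
    then have "trunc_mgf (trunc n) (?z n) = exp (Ln (1 + w n))" by (simp add: w_def)
    then have "trunc_mgf (trunc n) (?z n) ^ n = exp (of_nat n * Ln (1 + w n))"
      by (simp add: exp_of_nat_mult)
    also have "of_nat n * Ln (1 + w n) = of_nat n * (?z n)\<^sup>2 / 2 + of_real g * (of_nat n * ?z n ^ 3) / 6 + (of_nat n * R n + E n)"
      by (simp add: E_def R_def algebra_simps)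
    also have "of_nat n * (?z n)\<^sup>2 = ?Z n ^ 2" using tilt_point_sq[of n \<eta>] elim by (simp add: mult.commute)
    also have "of_nat n * ?z n ^ 3 = ?Z n ^ 3 / s"
      using s0 by (simp add: tilt_point_def s_def[symmetric] power3_eq_cube s2[symmetric] field_simps)
    finally have pow: "trunc_mgf (trunc n) (?z n) ^ n = exp (?Z n ^ 2 / 2 + of_real g * (?Z n ^ 3 / s) / 6 + (of_nat n * R n + E n))" .
    have "tilted_char n \<eta> = exp (of_real ((x n)\<^sup>2 / 2) + (?Z n ^ 2 / 2 + of_real g * (?Z n ^ 3 / s) / 6 + (of_nat n * R n + E n)) + - ?Z n * of_real (level n))"
      unfolding tilted_char_def pow exp_of_real[symmetric] by (simp only: exp_add)
    also have "of_real ((x n)\<^sup>2 / 2) + (?Z n ^ 2 / 2 + of_real g * (?Z n ^ 3 / s) / 6 + (of_nat n * R n + E n)) + - ?Z n * of_real (level n)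
       = of_real (- \<eta>\<^sup>2 / 2) + F n + (of_nat n * R n + E n)"
    proof -
      \<comment> \<open>The cancellation multiplied through by \<open>6 * s\<close>. The imaginary
        unit is abstracted to a number with square -1, which makes this a pure ring
        identity.\<close>
      have alg: "3 * (s * X\<^sup>2) + (3 * (s * (X + i * Y)\<^sup>2) + G * (X + i * Y) ^ 3) - (X + i * Y) * (X * (6 * s) + G * X\<^sup>2)
          = G * (i * Y) * (2 * X\<^sup>2 + 3 * i * Y * X - Y\<^sup>2) - 3 * (s * Y\<^sup>2)" if "i * i = -1" for X Y G i s :: complex
        using that by algebra
      have "of_real ((x n)\<^sup>2 / 2) + (?Z n ^ 2 / 2 + of_real g * (?Z n ^ 3 / s) / 6) - ?Z n * of_real (level n)
         = of_real (- \<eta>\<^sup>2 / 2) + F n"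
        unfolding Z F_def level_def of_real_add of_real_mult of_real_divide of_real_power s_def[symmetric] of_real_minus
        using s0 by (simp add: divide_simps) (rule alg, simp)
      then show ?thesis by (simp add: algebra_simps)
    qed
    finally show ?case by simp
  qed
  ultimately have "(\<lambda>n. tilted_char n \<eta>) \<longlonglongrightarrow> exp (of_real (- \<eta>\<^sup>2 / 2) + 0 + (0 + 0))"
    by (rule Lim_transform_eventually)
  then show ?thesis by (simp flip: exp_of_real)
qed

text \<open>The real part of the exponent contributes \<open>- \<eta>\<^sup>2 / 2\<close>. The
  skewness cross term costs at most \<open>\<eta>\<^sup>2 / 8\<close> because
  \<open>x n / sqrt n\<close> vanishes. The errors of order four cost another
  \<open>\<eta>\<^sup>2 / 8\<close>, by the choice of \<open>c0\<close>, plus a vanishing part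
  bounded by 1. Hence the exponent \<open>1 - \<eta>\<^sup>2 / 4\<close> and the constant
  \<open>exp 1\<close>.\<close>

lemma tilted_char_bound:
  obtains C c0 where "C \<ge> 0" "c0 > 0"
    "\<forall>\<^sub>F n in sequentially. \<forall>\<eta>. \<bar>\<eta>\<bar> \<le> c0 * sqrt (real n) \<longrightarrow> norm (tilted_char n \<eta>) \<le> C * exp (- \<eta>\<^sup>2 / 4)"
proof -
  have square_add_le: "(a + b)\<^sup>2 \<le> 2 * a\<^sup>2 + 2 * (b * b)" for a b :: real
    using sum_squares_bound[of a b] by (simp add: power2_eq_square algebra_simps)
  let ?s = "\<lambda>n. sqrt (real n)"
  define K where "K = rem_const"
  define G where "G = 1 / 2 + \<bar>g\<bar> / 6"
  \<comment> \<open>The coefficient of \<open>n * \<rho> ^ 4\<close> in the final exponent: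
    \<open>G\<^sup>2\<close> from the main part of \<open>norm w ^ 2\<close>, the next summand from
    the remainder \<open>R\<close>; the added 1 ensures positivity.\<close>
  define K' where "K' = G\<^sup>2 + (1 + 2 * K) * K + 1"
  \<comment> \<open>The bound 1/2 keeps \<open>\<eta>\<close> in the range of
    \<open>trunc_mgf_eventually\<close>; the other entry gives
    \<open>2 * K' * c0\<^sup>2 \<le> 1 / 8\<close>.\<close>
  define c0 where "c0 = min (1 / 2) (1 / (4 * sqrt K'))"
  have K: "K \<ge> 0" using rem_const_nonneg by (simp add: K_def)
  have K': "K' > 0" using K by (simp add: K'_def add_nonneg_pos)
  have c0: "c0 > 0" "c0 \<le> 1 / 2" using K' by (auto simp: c0_def)
  have c0K: "2 * K' * c0\<^sup>2 \<le> 1 / 8"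
  proof -
    have "c0\<^sup>2 \<le> (1 / (4 * sqrt K'))\<^sup>2" using c0 by (intro power_mono) (auto simp: c0_def)
    also have "\<dots> = 1 / (16 * K')" using K' by (simp add: power_divide power_mult_distrib)
    finally show ?thesis using K' by (simp add: field_simps)
  qed
  have x4: "(\<lambda>n. ((x n)\<^sup>2)\<^sup>2 / real n) \<longlonglongrightarrow> 0"
  proof -
    have "(\<lambda>n. ((x n)\<^sup>2 / ?s n)\<^sup>2) \<longlonglongrightarrow> 0\<^sup>2" by (intro tendsto_intros x_sq)
    then show ?thesis by (simp add: power_divide)
  qed
  have "(\<lambda>n. \<bar>g\<bar> / 2 * (x n / ?s n)) \<longlonglongrightarrow> \<bar>g\<bar> / 2 * 0" by (intro tendsto_intros x_over_sqrt)
  then have e1: "\<forall>\<^sub>F n in sequentially. \<bar>g\<bar> / 2 * (x n / ?s n) < 1 / 8" by (rule order_tendstoD) simp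
  have "(\<lambda>n. 2 * K' * (((x n)\<^sup>2)\<^sup>2 / real n) + (1 + 2 * K) * K * (real n / trunc n ^ 4)) \<longlonglongrightarrow> 2 * K' * 0 + (1 + 2 * K) * K * 0"
    by (intro tendsto_intros x4 trunc_small)
  then have e2: "\<forall>\<^sub>F n in sequentially. 2 * K' * (((x n)\<^sup>2)\<^sup>2 / real n) + (1 + 2 * K) * K * (real n / trunc n ^ 4) < 1"
    by (rule order_tendstoD) simp
  have "\<forall>\<^sub>F n in sequentially. \<forall>\<eta>. \<bar>\<eta>\<bar> \<le> c0 * ?s n \<longrightarrow> norm (tilted_char n \<eta>) \<le> exp 1 * exp (- \<eta>\<^sup>2 / 4)"
    using trunc_mgf_eventually e1 e2 x_ge[of 1] eventually_gt_at_top[of 0]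
  proof eventually_elim
    case (elim n)
    show ?case
    proof (intro allI impI)
      fix \<eta> assume \<eta>: "\<bar>\<eta>\<bar> \<le> c0 * ?s n"
      define z where "z = tilt_point n \<eta>"
      define \<rho> where "\<rho> = norm z"
      define w where "w = trunc_mgf (trunc n) z - 1"
      define R where "R = w - (z\<^sup>2 / 2 + of_real g * z ^ 3 / 6)"
      define t where "t = 1 / trunc n ^ 4"
      have t: "0 \<le> t" by (simp add: t_def)
      have "c0 * ?s n \<le> 1 / 2 * ?s n" using c0 by (intro mult_right_mono) auto
      then have "\<bar>\<eta>\<bar> \<le> ?s n / 2" using \<eta> by simp
      with elim have \<rho>: "\<rho> \<le> 1" and R: "norm R \<le> K * \<rho> ^ 4 + K * t"
        by (auto simp: z_def \<rho>_def R_def w_def K_def t_def algebra_simps)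
      have \<rho>0: "\<rho> \<ge> 0" by (simp add: \<rho>_def)
      have s: "?s n > 0" using elim by simp
      have Rez: "Re z = x n / ?s n" and Imz: "Im z = \<eta> / ?s n"
        by (simp_all add: z_def tilt_point_def)
      have T1: "trunc n \<ge> 1"
        using elim mult_mono[of 1 "?s n" 1 "x n"] by (simp add: trunc_def)
      have t1: "t \<le> 1" using T1 by (simp add: t_def)
      have R2: "norm R \<le> 2 * K"
      proof -
        have "K * \<rho> ^ 4 \<le> K * 1" using \<rho> \<rho>0 K by (intro mult_left_mono power_le_one) auto
        moreover have "K * t \<le> K * 1" using t1 K by (intro mult_left_mono) auto
        ultimately show ?thesis using R by linarith
      qed
      have w_norm: "norm w ^ 2 \<le> 2 * G\<^sup>2 * \<rho> ^ 4 + 4 * K * norm R"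
      proof -
        have "norm (z\<^sup>2 / 2 + of_real g * z ^ 3 / 6) \<le> \<rho>\<^sup>2 / 2 + \<bar>g\<bar> / 6 * \<rho> ^ 3"
          by (rule norm_triangle_le) (simp add: norm_divide norm_mult norm_power \<rho>_def)
        also have "\<rho> ^ 3 \<le> \<rho>\<^sup>2" using \<rho> \<rho>0 by (intro power_decreasing) auto
        then have "\<rho>\<^sup>2 / 2 + \<bar>g\<bar> / 6 * \<rho> ^ 3 \<le> \<rho>\<^sup>2 / 2 + \<bar>g\<bar> / 6 * \<rho>\<^sup>2"
          by (intro add_left_mono mult_left_mono) auto
        also have "\<dots> = G * \<rho>\<^sup>2" by (simp add: G_def algebra_simps)
        finally have "norm w \<le> G * \<rho>\<^sup>2 + norm R"
          using norm_triangle_ineq[of "z\<^sup>2 / 2 + of_real g * z ^ 3 / 6" R] by (simp add: R_def)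
        then have "norm w ^ 2 \<le> (G * \<rho>\<^sup>2 + norm R)\<^sup>2" by (intro power_mono) auto
        also have "\<dots> \<le> 2 * (G * \<rho>\<^sup>2)\<^sup>2 + 2 * (norm R * norm R)" by (rule square_add_le)
        also have "norm R * norm R \<le> (2 * K) * norm R" using R2 by (intro mult_right_mono) auto
        finally show ?thesis by (simp add: power_mult_distrib flip: power_mult)
      qed
      have Re_w: "Re w = ((x n)\<^sup>2 - \<eta>\<^sup>2) / (2 * n) + g * (x n ^ 3 - 3 * x n * \<eta>\<^sup>2) / (6 * n * ?s n) + Re R"
      proof -
        have s2: "?s n * ?s n = n" by simp
        have "Re (z\<^sup>2) = ((x n)\<^sup>2 - \<eta>\<^sup>2) / n"
          using s by (simp add: power2_eq_square Rez Imz diff_divide_distrib)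
        moreover have "Re (z ^ 3) = (x n ^ 3 - 3 * x n * \<eta>\<^sup>2) / (n * ?s n)"
          using s by (simp add: power3_eq_cube power2_eq_square Rez Imz field_simps)
        ultimately show ?thesis by (simp add: R_def algebra_simps)
      qed
      \<comment> \<open>In \<open>\<eta> ^ 4 / n\<close> one factor
        \<open>\<eta>\<^sup>2 / n\<close> is at most \<open>c0\<^sup>2\<close>, so a quartic error
        becomes a small multiple of \<open>\<eta>\<^sup>2\<close>.\<close>
      have n\<rho>: "n * \<rho> ^ 4 \<le> 2 * (((x n)\<^sup>2)\<^sup>2 / n) + 2 * c0\<^sup>2 * \<eta>\<^sup>2"
      proof -
        have "n * \<rho> ^ 4 = ((x n)\<^sup>2 + \<eta>\<^sup>2)\<^sup>2 / n" using norm_tilt_point_4[of n \<eta>] elim by (simp add: \<rho>_def z_def)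
        also have "\<dots> \<le> (2 * ((x n)\<^sup>2)\<^sup>2 + 2 * (\<eta>\<^sup>2 * \<eta>\<^sup>2)) / n"
          by (intro divide_right_mono square_add_le) simp
        also have "\<dots> = 2 * (((x n)\<^sup>2)\<^sup>2 / n) + 2 * (\<eta>\<^sup>2 / n * \<eta>\<^sup>2)" by (simp add: add_divide_distrib)
        also have "\<eta>\<^sup>2 / n * \<eta>\<^sup>2 \<le> c0\<^sup>2 * \<eta>\<^sup>2"
        proof (rule mult_right_mono)
          have "\<bar>\<eta>\<bar>\<^sup>2 \<le> (c0 * ?s n)\<^sup>2" using \<eta> by (intro power_mono) auto
          then show "\<eta>\<^sup>2 / n \<le> c0\<^sup>2" using elim by (simp add: power_mult_distrib field_simps)
        qed simp
        finally show ?thesis by simp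
      qed
      have nR: "n * norm R \<le> K * (n * \<rho> ^ 4) + K * (n / trunc n ^ 4)"
        using mult_left_mono[OF R, of n] by (simp add: t_def algebra_simps)
      \<comment> \<open>The square of the modulus is \<open>1 + (2 * Re w + norm w ^ 2)\<close>, at
        most the exponential of the bracket. No logarithm is used, so \<open>w\<close> need not be
        small.\<close>
      have "norm (1 + w) \<le> exp (Re w + norm w ^ 2 / 2)"
      proof (rule power2_le_imp_le)
        have "norm (1 + w) ^ 2 = 1 + (2 * Re w + norm w ^ 2)"
          by (simp only: cmod_power2 plus_complex.simps one_complex.simps) (simp add: power2_eq_square algebra_simps)
        also have "\<dots> \<le> exp (2 * Re w + norm w ^ 2)" by (rule exp_ge_add_one_self)
        also have "\<dots> = exp (Re w + norm w ^ 2 / 2) ^ 2" by (simp add: power2_eq_square flip: exp_add)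
        finally show "norm (1 + w) ^ 2 \<le> exp (Re w + norm w ^ 2 / 2) ^ 2" .
      qed simp
      then have "norm (1 + w) ^ n \<le> exp (Re w + norm w ^ 2 / 2) ^ n" by (intro power_mono) auto
      also have "\<dots> = exp (n * Re w + n * norm w ^ 2 / 2)" by (simp add: exp_of_nat_mult[symmetric] algebra_simps)
      finally have "norm (tilted_char n \<eta>) \<le> exp ((x n)\<^sup>2 / 2) * exp (n * Re w + n * norm w ^ 2 / 2) * exp (- x n * level n)"
        unfolding tilted_char_def norm_mult norm_power norm_of_real z_def[symmetric]
        by (simp add: w_def mult_left_mono)
      also have "\<dots> = exp ((x n)\<^sup>2 / 2 + (n * Re w + n * norm w ^ 2 / 2) + - x n * level n)"
        by (simp only: exp_add)
      also have "\<dots> \<le> exp (1 + - \<eta>\<^sup>2 / 4)"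
      proof -
        have 1: "n * Re w = ((x n)\<^sup>2 - \<eta>\<^sup>2) / 2 + g * (x n ^ 3 - 3 * x n * \<eta>\<^sup>2) / (6 * ?s n) + n * Re R"
          using elim by (simp add: Re_w field_simps)
        have 2: "n * Re R \<le> n * norm R" by (intro mult_left_mono complex_Re_le_cmod) auto
        have 3: "n * norm w ^ 2 / 2 \<le> G\<^sup>2 * (n * \<rho> ^ 4) + 2 * K * (n * norm R)"
          using mult_left_mono[OF w_norm, of "n / 2"] by (simp add: algebra_simps)
        have 4: "n * norm R + 2 * K * (n * norm R) \<le> (1 + 2 * K) * K * (n * \<rho> ^ 4) + (1 + 2 * K) * K * (n / trunc n ^ 4)"
          using mult_left_mono[OF nR, of "1 + 2 * K"] K by (simp add: algebra_simps)
        have 5: "(G\<^sup>2 + (1 + 2 * K) * K) * (n * \<rho> ^ 4) \<le> K' * (2 * (((x n)\<^sup>2)\<^sup>2 / n) + 2 * c0\<^sup>2 * \<eta>\<^sup>2)"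
          using n\<rho> \<rho>0 K' K by (intro mult_mono) (auto simp: K'_def)
        have 6: "2 * K' * c0\<^sup>2 * \<eta>\<^sup>2 \<le> 1 / 8 * \<eta>\<^sup>2" using c0K by (intro mult_right_mono) auto
        have 7: "x n * level n = (x n)\<^sup>2 + g * x n ^ 3 / (6 * ?s n)"
          by (simp add: level_def algebra_simps power2_eq_square power3_eq_cube)
        have 8: "g * (x n ^ 3 - 3 * x n * \<eta>\<^sup>2) / (6 * ?s n) = g * x n ^ 3 / (6 * ?s n) - g / 2 * (x n / ?s n) * \<eta>\<^sup>2"
          using s by (simp add: field_simps)
        have 9: "- (g / 2 * (x n / ?s n)) * \<eta>\<^sup>2 \<le> 1 / 8 * \<eta>\<^sup>2"
        proof (rule mult_right_mono)
          have "- (g / 2) * (x n / ?s n) \<le> \<bar>g\<bar> / 2 * (x n / ?s n)" using elim s by (intro mult_right_mono) auto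
          then show "- (g / 2 * (x n / ?s n)) \<le> 1 / 8" using elim(2) by linarith
        qed simp
        have 10: "K' * (2 * (((x n)\<^sup>2)\<^sup>2 / n) + 2 * c0\<^sup>2 * \<eta>\<^sup>2) = 2 * K' * (((x n)\<^sup>2)\<^sup>2 / n) + 2 * K' * c0\<^sup>2 * \<eta>\<^sup>2"
          by (simp add: algebra_simps)
        have 11: "(G\<^sup>2 + (1 + 2 * K) * K) * (n * \<rho> ^ 4) = G\<^sup>2 * (n * \<rho> ^ 4) + (1 + 2 * K) * K * (n * \<rho> ^ 4)"
          by (rule distrib_right)
        have 12: "- (g / 2 * (x n / ?s n)) * \<eta>\<^sup>2 = - (g / 2 * (x n / ?s n) * \<eta>\<^sup>2)" by simp
        have 13: "((x n)\<^sup>2 - \<eta>\<^sup>2) / 2 = (x n)\<^sup>2 / 2 - \<eta>\<^sup>2 / 2" by (rule diff_divide_distrib)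
        from elim(3) have 14: "2 * K' * (((x n)\<^sup>2)\<^sup>2 / n) + (1 + 2 * K) * K * (n / trunc n ^ 4) < 1" .
        have 15: "- x n * level n = - (x n * level n)" by simp
        \<comment> \<open>The terms \<open>(x n)\<^sup>2\<close> and
          \<open>g * x n ^ 3 / (6 * sqrt n)\<close> cancel against \<open>x n * level n\<close>;
          facts 6 and 9 each take back \<open>\<eta>\<^sup>2 / 8\<close>, and fact 14 bounds the
          rest by 1.\<close>
        have "(x n)\<^sup>2 / 2 + (n * Re w + n * norm w ^ 2 / 2) + - x n * level n \<le> 1 + - \<eta>\<^sup>2 / 4"
          using 1 2 3 4 5 6 7 8 9 10 11 12 13 14 15 by linarith
        then show ?thesis by simp
      qed
      finally show "norm (tilted_char n \<eta>) \<le> exp 1 * exp (- \<eta>\<^sup>2 / 4)"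
        by (simp only: exp_add)
    qed
  qed
  then show thesis using c0 by (intro that[of "exp 1" c0]) auto
qed

end

section \<open>The tilted law of the normalised sum\<close>

context moderate_deviation
begin

definition std_sum :: "nat \<Rightarrow> (nat \<Rightarrow> 'a \<Rightarrow> real) \<Rightarrow> 'a \<Rightarrow> real" where
  "std_sum n X \<omega> = (\<Sum>i=1..n. X i \<omega>) / sqrt (real n) - level n"

text \<open>The exponential tilt on the truncation event, scaled by
  \<open>exp ((x n)\<^sup>2 / 2)\<close> and not by the exact normalising constant. The tilted law
  is thus only a finite measure, whose mass tends to 1 by \<open>tilted_char_limit\<close> at
  0.\<close>

definition tilt_weight :: "nat \<Rightarrow> (nat \<Rightarrow> 'a \<Rightarrow> real) \<Rightarrow> 'a \<Rightarrow> real" where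
  "tilt_weight n X \<omega> = exp ((x n)\<^sup>2 / 2) * exp (x n * std_sum n X \<omega>)
     * indicator {\<omega>. \<forall>i\<in>{1..n}. \<bar>X i \<omega>\<bar> \<le> trunc n} \<omega>"

definition tilted_law :: "nat \<Rightarrow> (nat \<Rightarrow> 'a \<Rightarrow> real) \<Rightarrow> 'a measure \<Rightarrow> real measure" where
  "tilted_law n X M = distr (density M (\<lambda>\<omega>. ennreal (tilt_weight n X \<omega>))) borel (std_sum n X)"

context
  fixes n :: nat and M :: "'a measure" and X :: "nat \<Rightarrow> 'a \<Rightarrow> real"
  assumes prob: "prob_space M" and indep: "prob_space.indep_vars M (\<lambda>_. borel) X {1..n}"
    and law: "\<And>i. i \<in> {1..n} \<Longrightarrow> distr M borel (X i) = D"
begin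

interpretation prob_space M by (rule prob)

lemma meas_X: "i \<in> {1..n} \<Longrightarrow> X i \<in> borel_measurable M"
  using indep by (auto simp: indep_vars_def)

lemma meas_std_sum [measurable]: "std_sum n X \<in> borel_measurable M"
proof -
  have "(\<lambda>\<omega>. \<Sum>i=1..n. X i \<omega>) \<in> borel_measurable M" by (rule borel_measurable_sum) (rule meas_X)
  then show ?thesis unfolding std_sum_def by measurable
qed

lemma meas_trunc_event [measurable]: "Measurable.pred M (\<lambda>\<omega>. \<forall>i\<in>{1..n}. \<bar>X i \<omega>\<bar> \<le> trunc n)"
proof (rule pred_intros_finite)
  fix i assume "i \<in> {1..n}"
  note [measurable] = meas_X[OF this]
  show "Measurable.pred M (\<lambda>\<omega>. \<bar>X i \<omega>\<bar> \<le> trunc n)" by measurable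
qed simp

lemma meas_tilt_weight [measurable]: "tilt_weight n X \<in> borel_measurable M"
  unfolding tilt_weight_def indicator_def of_bool_def mem_Collect_eq by measurable

lemma tilt_weight_nonneg: "0 \<le> tilt_weight n X \<omega>"
  by (simp add: tilt_weight_def)

lemma integrable_tilt_weight: "integrable M (tilt_weight n X)"
proof (rule integrable_const_bound)
  let ?B = "exp ((x n)\<^sup>2 / 2) * exp (\<bar>x n\<bar> * (real n * \<bar>trunc n\<bar> / sqrt (real n) + \<bar>level n\<bar>))"
  show "AE \<omega> in M. norm (tilt_weight n X \<omega>) \<le> ?B"
  proof (rule AE_I2)
    fix \<omega>
    show "norm (tilt_weight n X \<omega>) \<le> ?B"
    proof (cases "\<forall>i\<in>{1..n}. \<bar>X i \<omega>\<bar> \<le> trunc n")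
      case True
      have "\<bar>\<Sum>i=1..n. X i \<omega>\<bar> \<le> (\<Sum>i=1..n. \<bar>trunc n\<bar>)"
        by (rule order_trans[OF sum_abs sum_mono]) (use True in force)
      then have "\<bar>\<Sum>i=1..n. X i \<omega>\<bar> / sqrt (real n) \<le> real n * \<bar>trunc n\<bar> / sqrt (real n)"
        by (intro divide_right_mono) auto
      then have "\<bar>std_sum n X \<omega>\<bar> \<le> real n * \<bar>trunc n\<bar> / sqrt (real n) + \<bar>level n\<bar>"
        unfolding std_sum_def using abs_triangle_ineq4[of "(\<Sum>i=1..n. X i \<omega>) / sqrt (real n)" "level n"] by (simp add: abs_divide)
      then have "\<bar>x n\<bar> * \<bar>std_sum n X \<omega>\<bar> \<le> \<bar>x n\<bar> * (real n * \<bar>trunc n\<bar> / sqrt (real n) + \<bar>level n\<bar>)"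
        by (intro mult_left_mono) auto
      moreover have "x n * std_sum n X \<omega> \<le> \<bar>x n\<bar> * \<bar>std_sum n X \<omega>\<bar>" by (metis abs_ge_self abs_mult)
      ultimately have "exp (x n * std_sum n X \<omega>) \<le> exp (\<bar>x n\<bar> * (real n * \<bar>trunc n\<bar> / sqrt (real n) + \<bar>level n\<bar>))"
        by simp
      then show ?thesis using True by (simp add: tilt_weight_def indicator_def)
    next
      case False
      then show ?thesis by (auto simp: tilt_weight_def indicator_def)
    qed
  qed
qed measurable

lemma sets_tilted_law: "sets (tilted_law n X M) = sets borel"
  by (simp add: tilted_law_def)

lemma finite_measure_tilted_law: "finite_measure (tilted_law n X M)"
proof (rule finite_measureI)
  have "emeasure (tilted_law n X M) (space (tilted_law n X M)) = (\<integral>\<^sup>+\<omega>. ennreal (tilt_weight n X \<omega>) \<partial>M)"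
    by (simp add: tilted_law_def emeasure_distr emeasure_density cong: nn_integral_cong)
  also have "\<dots> = ennreal (LINT \<omega>|M. tilt_weight n X \<omega>)"
    by (intro nn_integral_eq_integral integrable_tilt_weight AE_I2 tilt_weight_nonneg)
  finally show "emeasure (tilted_law n X M) (space (tilted_law n X M)) \<noteq> \<infinity>" by simp
qed

lemma integral_tilted_law:
  fixes f :: "real \<Rightarrow> 'b :: {banach, second_countable_topology}"
  assumes [measurable]: "f \<in> borel_measurable borel"
  shows "(LINT v|tilted_law n X M. f v) = (LINT \<omega>|M. tilt_weight n X \<omega> *\<^sub>R f (std_sum n X \<omega>))"
  unfolding tilted_law_def
  by (subst integral_distr, simp, simp, rule integral_density) (simp_all add: tilt_weight_nonneg)

text \<open>Both the exponential of the sum and the indicator of the truncation event factor over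
  the coordinates, so independence yields the \<open>n\<close>-th power of one truncated generating
  function.\<close>

lemma char_tilted_law: "char (tilted_law n X M) \<eta> = tilted_char n \<eta>"
proof -
  let ?z = "tilt_point n \<eta>"
  let ?f = "\<lambda>y. indicator {- trunc n..trunc n} y *\<^sub>R exp (?z * complex_of_real y)"
  have f_int: "complex_integrable M (\<lambda>\<omega>. ?f (X i \<omega>))" "(LINT \<omega>|M. ?f (X i \<omega>)) = trunc_mgf (trunc n) ?z" if i: "i \<in> {1..n}" for i
    using integrable_distr_eq[OF meas_X[OF i], of ?f] integral_distr[OF meas_X[OF i], of ?f] integrable_trunc_exp[of "trunc n" ?z]
    by (simp_all add: law[OF i] trunc_mgf_def)
  have "char (tilted_law n X M) \<eta> = (LINT \<omega>|M. tilt_weight n X \<omega> *\<^sub>R iexp (\<eta> * std_sum n X \<omega>))"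
    unfolding char_def by (rule integral_tilted_law) simp
  also have "\<dots> = (LINT \<omega>|M. of_real (exp ((x n)\<^sup>2 / 2)) * exp (- Complex (x n) \<eta> * of_real (level n)) * (\<Prod>i=1..n. ?f (X i \<omega>)))"
  proof (rule Bochner_Integration.integral_cong[OF refl])
    fix \<omega>
    show "tilt_weight n X \<omega> *\<^sub>R iexp (\<eta> * std_sum n X \<omega>)
      = of_real (exp ((x n)\<^sup>2 / 2)) * exp (- Complex (x n) \<eta> * of_real (level n)) * (\<Prod>i=1..n. ?f (X i \<omega>))"
    proof (cases "\<forall>i\<in>{1..n}. \<bar>X i \<omega>\<bar> \<le> trunc n")
      case True
      have "(\<Prod>i=1..n. ?f (X i \<omega>)) = (\<Prod>i=1..n. exp (?z * complex_of_real (X i \<omega>)))"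
      proof (rule prod.cong[OF refl])
        fix i assume "i \<in> {1..n}"
        then have "\<bar>X i \<omega>\<bar> \<le> trunc n" using True by blast
        then show "?f (X i \<omega>) = exp (?z * complex_of_real (X i \<omega>))" by (simp add: indicator_def abs_le_iff)
      qed
      also have "\<dots> = exp (Complex (x n) \<eta> * of_real ((\<Sum>i=1..n. X i \<omega>) / sqrt (real n)))"
        by (simp add: exp_sum[symmetric] sum_distrib_left sum_divide_distrib tilt_point_def)
      finally have "of_real (exp ((x n)\<^sup>2 / 2)) * exp (- Complex (x n) \<eta> * of_real (level n)) * (\<Prod>i=1..n. ?f (X i \<omega>))
        = of_real (exp ((x n)\<^sup>2 / 2)) * exp (Complex (x n) \<eta> * of_real (std_sum n X \<omega>))"
        by (simp only: mult.assoc exp_add[symmetric] std_sum_def of_real_diff) (simp add: algebra_simps)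
      also have "Complex (x n) \<eta> * of_real (std_sum n X \<omega>) = of_real (x n * std_sum n X \<omega>) + \<i> * of_real (\<eta> * std_sum n X \<omega>)"
        by (simp add: complex_eq_iff)
      finally show ?thesis using True
        by (simp add: tilt_weight_def indicator_def scaleR_conv_of_real exp_add flip: exp_of_real)
    next
      case False
      \<comment> \<open>A single coordinate beyond the truncation point annihilates the product,
        matching the indicator in the weight.\<close>
      then obtain i where "i \<in> {1..n}" "\<not> \<bar>X i \<omega>\<bar> \<le> trunc n" by blast
      then have "?f (X i \<omega>) = 0" by (auto simp: indicator_def abs_le_iff)
      with \<open>i \<in> {1..n}\<close> have "(\<Prod>i=1..n. ?f (X i \<omega>)) = 0" by (intro prod_zero) auto
      then show ?thesis using False by (auto simp: tilt_weight_def indicator_def)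
    qed
  qed
  also have "\<dots> = of_real (exp ((x n)\<^sup>2 / 2)) * exp (- Complex (x n) \<eta> * of_real (level n)) * (LINT \<omega>|M. (\<Prod>i=1..n. ?f (X i \<omega>)))"
    by (rule integral_mult_right_zero)
  also have "(LINT \<omega>|M. (\<Prod>i=1..n. ?f (X i \<omega>))) = (\<Prod>i=1..n. LINT \<omega>|M. ?f (X i \<omega>))"
    by (intro indep_vars_lebesgue_integral indep_vars_compose2[OF indep] f_int) auto
  also have "\<dots> = trunc_mgf (trunc n) ?z ^ n" using f_int(2) by simp
  finally show ?thesis by (simp add: tilted_char_def mult_ac)
qed

text \<open>The factor \<open>exp (- (x n * v))\<close> cancels the tilt, leaving only the constant
  and the truncation indicator.\<close>

lemma untilt:
  assumes [measurable]: "B \<in> sets borel"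
  shows "(LINT v|tilted_law n X M. exp (- (x n * v)) * indicator B v)
    = exp ((x n)\<^sup>2 / 2) * measure M {\<omega> \<in> space M. std_sum n X \<omega> \<in> B \<and> (\<forall>i\<in>{1..n}. \<bar>X i \<omega>\<bar> \<le> trunc n)}"
proof -
  let ?E = "{\<omega> \<in> space M. std_sum n X \<omega> \<in> B \<and> (\<forall>i\<in>{1..n}. \<bar>X i \<omega>\<bar> \<le> trunc n)}"
  have [measurable]: "?E \<in> sets M" by measurable
  have "(LINT v|tilted_law n X M. exp (- (x n * v)) * indicator B v)
     = (LINT \<omega>|M. tilt_weight n X \<omega> *\<^sub>R (exp (- (x n * std_sum n X \<omega>)) * indicator B (std_sum n X \<omega>)))"
    by (rule integral_tilted_law) simp
  also have "\<dots> = (LINT \<omega>|M. exp ((x n)\<^sup>2 / 2) * indicator ?E \<omega>)"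
  proof (rule Bochner_Integration.integral_cong[OF refl])
    fix \<omega> assume "\<omega> \<in> space M"
    then show "tilt_weight n X \<omega> *\<^sub>R (exp (- (x n * std_sum n X \<omega>)) * indicator B (std_sum n X \<omega>)) = exp ((x n)\<^sup>2 / 2) * indicator ?E \<omega>"
      by (auto simp: tilt_weight_def indicator_def exp_minus)
  qed
  also have "\<dots> = exp ((x n)\<^sup>2 / 2) * measure M (?E \<inter> space M)"
    by (simp only: integral_mult_right_zero Bochner_Integration.integral_indicator)
  also have "?E \<inter> space M = ?E" by blast
  finally show ?thesis .
qed

text \<open>Union bound over the \<open>n\<close> coordinates, followed by Markov's inequality for
  the exponential moment in \<open>subexp\<close>.\<close>

lemma truncation_error:
  assumes [measurable]: "B \<in> sets borel" and T: "trunc n \<ge> 0"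
  shows "\<bar>measure M {\<omega> \<in> space M. std_sum n X \<omega> \<in> B}
      - measure M {\<omega> \<in> space M. std_sum n X \<omega> \<in> B \<and> (\<forall>i\<in>{1..n}. \<bar>X i \<omega>\<bar> \<le> trunc n)}\<bar>
    \<le> real n * ((LINT y|D. exp (c * \<bar>y\<bar> powr \<kappa>)) * exp (- c * trunc n powr \<kappa>))"
proof -
  let ?A = "{\<omega> \<in> space M. std_sum n X \<omega> \<in> B}"
  let ?E = "{\<omega> \<in> space M. std_sum n X \<omega> \<in> B \<and> (\<forall>i\<in>{1..n}. \<bar>X i \<omega>\<bar> \<le> trunc n)}"
  let ?U = "\<lambda>i. {\<omega> \<in> space M. \<bar>X i \<omega>\<bar> > trunc n}"
  have U [measurable]: "?U i \<in> sets M" if "i \<in> {1..n}" for i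
    using meas_X[OF that] by measurable
  have E [measurable]: "?E \<in> sets M" and A [measurable]: "?A \<in> sets M" by measurable
  have UU: "(\<Union>i\<in>{1..n}. ?U i) \<in> sets M" using U by (intro sets.finite_UN) auto
  have "measure M ?E \<le> measure M ?A" by (intro finite_measure_mono A) auto
  moreover have "measure M ?A \<le> measure M (?E \<union> (\<Union>i\<in>{1..n}. ?U i))"
    using UU by (intro finite_measure_mono sets.Un E) (auto simp: not_le)
  moreover have "measure M (?E \<union> (\<Union>i\<in>{1..n}. ?U i)) \<le> measure M ?E + measure M (\<Union>i\<in>{1..n}. ?U i)"
    using UU by (intro measure_Un_le E)
  moreover have "measure M (\<Union>i\<in>{1..n}. ?U i) \<le> (\<Sum>i=1..n. measure M (?U i))"
    using U by (intro measure_UNION_le) auto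
  moreover have "(\<Sum>i=1..n. measure M (?U i)) \<le> (\<Sum>i=1..n. (LINT y|D. exp (c * \<bar>y\<bar> powr \<kappa>)) * exp (- c * trunc n powr \<kappa>))"
  proof (rule sum_mono)
    fix i assume i: "i \<in> {1..n}"
    note [measurable] = meas_X[OF i]
    have "measure M (?U i) = measure (distr M borel (X i)) {y. \<bar>y\<bar> > trunc n}"
      by (subst measure_distr) (auto intro!: arg_cong[where f = "measure M"])
    also have "\<dots> = (LINT y|D. indicator {y. \<bar>y\<bar> > trunc n} y)" unfolding law[OF i] by simp
    also have "\<dots> \<le> (LINT y|D. exp (c * \<bar>y\<bar> powr \<kappa>) * exp (- c * trunc n powr \<kappa>))"
    proof (rule integral_mono)
      show "integrable D (\<lambda>y. exp (c * \<bar>y\<bar> powr \<kappa>) * exp (- c * trunc n powr \<kappa>))"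
        by (intro integrable_mult_left subexp)
      show "integrable D (\<lambda>y. indicator {y. \<bar>y\<bar> > trunc n} y :: real)"
        by (intro D.integrable_const_bound[of _ 1]) auto
      fix y
      have "trunc n powr \<kappa> \<le> \<bar>y\<bar> powr \<kappa>" if "\<bar>y\<bar> > trunc n"
        using that T kappa by (intro powr_mono2) auto
      then have "1 \<le> exp (c * \<bar>y\<bar> powr \<kappa> + - c * trunc n powr \<kappa>)" if "\<bar>y\<bar> > trunc n"
        using that c by simp
      then show "indicator {y. \<bar>y\<bar> > trunc n} y \<le> exp (c * \<bar>y\<bar> powr \<kappa>) * exp (- c * trunc n powr \<kappa>)"
        unfolding exp_add by (auto simp: indicator_def)
    qed
    also have "\<dots> = (LINT y|D. exp (c * \<bar>y\<bar> powr \<kappa>)) * exp (- c * trunc n powr \<kappa>)"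
      by (rule integral_mult_left_zero)
    finally show "measure M (?U i) \<le> (LINT y|D. exp (c * \<bar>y\<bar> powr \<kappa>)) * exp (- c * trunc n powr \<kappa>)" .
  qed
  ultimately show ?thesis by simp
qed

end

section \<open>Moderate deviations for row-wise independent arrays\<close>

text \<open>Eventually \<open>(x n)\<^sup>2 / 2\<close> uses up at most half of
  \<open>c * trunc n powr \<kappa>\<close>. The other half is at least
  \<open>c / 2 * n powr (1 / 4)\<close>, since \<open>trunc n \<ge> sqrt n\<close> and
  \<open>\<kappa> \<ge> 1 / 2\<close>, and it beats the factor \<open>x n * n\<close>.\<close>

lemma truncation_negligible:
  "(\<lambda>n. x n * exp ((x n)\<^sup>2 / 2) * (real n * (K * exp (- c * trunc n powr \<kappa>)))) \<longlonglongrightarrow> 0"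
proof (rule Lim_null_comparison)
  show "(\<lambda>n. \<bar>K\<bar> * (real n powr (3 / 2) * exp (- (c / 2) * real n powr (1 / 4)))) \<longlonglongrightarrow> 0"
    using c by real_asymp
  have "\<forall>\<^sub>F n in sequentially. (x n)\<^sup>2 / sqrt (real n) < 1" using x_sq by (rule order_tendstoD) simp
  moreover have "\<forall>\<^sub>F n in sequentially. (x n)\<^sup>2 / (sqrt (real n) * x n) powr \<kappa> < c"
    using x_trunc by (rule order_tendstoD) (rule c)
  ultimately show "\<forall>\<^sub>F n in sequentially. norm (x n * exp ((x n)\<^sup>2 / 2) * (real n * (K * exp (- c * trunc n powr \<kappa>))))
     \<le> \<bar>K\<bar> * (real n powr (3 / 2) * exp (- (c / 2) * real n powr (1 / 4)))"
    using x_ge[of 1] eventually_gt_at_top[of 0]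
  proof eventually_elim
    case (elim n)
    have s: "sqrt (real n) \<ge> 1" using elim by simp
    have T: "trunc n \<ge> sqrt (real n)" using elim s by (simp add: trunc_def)
    have "x n \<le> (x n)\<^sup>2" using elim by (simp add: power2_eq_square)
    also have "\<dots> \<le> sqrt (real n)" using elim s by (simp add: divide_simps split: if_splits)
    finally have x: "x n \<le> sqrt (real n)" .
    have "trunc n > 0" using T s by linarith
    then have Tp: "trunc n powr \<kappa> > 0" by simp
    have xT: "(x n)\<^sup>2 / 2 \<le> c / 2 * trunc n powr \<kappa>"
      using elim Tp by (simp add: trunc_def divide_simps split: if_splits)
    have "real n powr (1 / 4) = sqrt (real n) powr (1 / 2)"
      using elim by (simp add: powr_half_sqrt[symmetric] powr_powr)
    also have "\<dots> \<le> sqrt (real n) powr \<kappa>" using s kappa by (intro powr_mono) auto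
    also have "\<dots> \<le> trunc n powr \<kappa>" using s T kappa by (intro powr_mono2) auto
    finally have "c / 2 * real n powr (1 / 4) \<le> c / 2 * trunc n powr \<kappa>" using c by (intro mult_left_mono) auto
    with xT have e: "(x n)\<^sup>2 / 2 + - c * trunc n powr \<kappa> \<le> - (c / 2) * real n powr (1 / 4)" by simp
    have "norm (x n * exp ((x n)\<^sup>2 / 2) * (real n * (K * exp (- c * trunc n powr \<kappa>))))
      = \<bar>K\<bar> * ((x n * real n) * exp ((x n)\<^sup>2 / 2 + - c * trunc n powr \<kappa>))"
      using elim unfolding exp_add by (simp add: abs_mult)
    also have "\<dots> \<le> \<bar>K\<bar> * ((sqrt (real n) * real n) * exp (- (c / 2) * real n powr (1 / 4)))"
      using x e elim by (intro mult_left_mono mult_mono) auto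
    also have "sqrt (real n) * real n = real n powr (3 / 2)"
    proof -
      have "real n powr (3 / 2) = real n powr (1 / 2 + 1)" by simp
      also have "\<dots> = real n powr (1 / 2) * real n powr 1" by (rule powr_add)
      finally show ?thesis using elim by (simp add: powr_half_sqrt)
    qed
    finally show ?case .
  qed
qed

text \<open>The probability space may change with \<open>n\<close>: under the local alternative the
  parameter, and with it the joint law, depends on \<open>n\<close>. Only the common law
  \<open>D\<close> of the entries is fixed.\<close>

theorem moderate_deviation_limit:
  fixes M :: "nat \<Rightarrow> 'a measure" and X :: "nat \<Rightarrow> nat \<Rightarrow> 'a \<Rightarrow> real"
  assumes prob: "\<And>n. prob_space (M n)"
    and indep: "\<And>n. prob_space.indep_vars (M n) (\<lambda>_. borel) (X n) {1..n}"
    and law: "\<And>n i. i \<in> {1..n} \<Longrightarrow> distr (M n) borel (X n i) = D"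
    and B: "{0<..} \<subseteq> B" "B \<subseteq> {0..}"
  shows "(\<lambda>n. x n * exp ((x n)\<^sup>2 / 2) * measure (M n) {\<omega> \<in> space (M n). std_sum n (X n) \<omega> \<in> B}) \<longlonglongrightarrow> 1 / sqrt (2 * pi)"
proof -
  let ?A = "\<lambda>n. measure (M n) {\<omega> \<in> space (M n). std_sum n (X n) \<omega> \<in> B}"
  let ?E = "\<lambda>n. measure (M n) {\<omega> \<in> space (M n). std_sum n (X n) \<omega> \<in> B \<and> (\<forall>i\<in>{1..n}. \<bar>X n i \<omega>\<bar> \<le> trunc n)}"
  have "B = {0<..} \<or> B = {0..}" using B by (cases "0 \<in> B") (force simp: order_le_less)+
  then have [measurable]: "B \<in> sets borel" by auto
  obtain C c0 where C: "C \<ge> 0" "c0 > 0" and bound: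
    "\<forall>\<^sub>F n in sequentially. \<forall>\<eta>. \<bar>\<eta>\<bar> \<le> c0 * sqrt (real n) \<longrightarrow> norm (tilted_char n \<eta>) \<le> C * exp (- \<eta>\<^sup>2 / 4)"
    by (rule tilted_char_bound)
  \<comment> \<open>The Gaussian bound reaches frequencies of order \<open>sqrt n\<close>, the local
    limit argument needs them up to \<open>(x n)\<^sup>2\<close>; \<open>x_sq\<close> reconciles the
    two.\<close>
  have r: "\<forall>\<^sub>F n in sequentially. (x n)\<^sup>2 \<le> c0 * sqrt (real n)"
  proof -
    have "\<forall>\<^sub>F n in sequentially. (x n)\<^sup>2 / sqrt (real n) < c0" using x_sq by (rule order_tendstoD) (rule C)
    then show ?thesis using eventually_gt_at_top[of 0]
      by eventually_elim (simp add: divide_simps)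
  qed
  have "(\<lambda>n. x n * (LINT v|tilted_law n (X n) (M n). exp (- (x n * v)) * indicator B v)) \<longlonglongrightarrow> 1 / sqrt (2 * pi)"
  proof (rule exponential_tail_limit[OF _ _ x_top _ C(1) _ r B])
    have ch: "char (tilted_law n (X n) (M n)) \<eta> = tilted_char n \<eta>" for n \<eta>
      by (rule char_tilted_law[OF prob indep]) (rule law)
    show "finite_measure (tilted_law n (X n) (M n))" for n
      by (rule finite_measure_tilted_law[OF prob indep]) (rule law)
    show "sets (tilted_law n (X n) (M n)) = sets borel" for n
      by (rule sets_tilted_law[OF prob indep]) (rule law)
    show "(\<lambda>n. char (tilted_law n (X n) (M n)) \<eta>) \<longlonglongrightarrow> of_real (exp (- \<eta>\<^sup>2 / 2))" for \<eta>
      unfolding ch by (rule tilted_char_limit)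
    show "\<forall>\<^sub>F n in sequentially. \<forall>\<eta>. \<bar>\<eta>\<bar> \<le> c0 * sqrt (real n) \<longrightarrow>
        norm (char (tilted_law n (X n) (M n)) \<eta>) \<le> C * exp (- \<eta>\<^sup>2 / 4)"
      unfolding ch by (rule bound)
  qed
  moreover have "(LINT v|tilted_law n (X n) (M n). exp (- (x n * v)) * indicator B v) = exp ((x n)\<^sup>2 / 2) * ?E n" for n
    by (rule untilt[OF prob indep]) (auto intro: law)
  ultimately have "(\<lambda>n. x n * (exp ((x n)\<^sup>2 / 2) * ?E n)) \<longlonglongrightarrow> 1 / sqrt (2 * pi)"
    by (simp only:)
  moreover have "(\<lambda>n. x n * exp ((x n)\<^sup>2 / 2) * (?A n - ?E n)) \<longlonglongrightarrow> 0"
  proof (rule Lim_null_comparison[OF _ truncation_negligible[of "LINT y|D. exp (c * \<bar>y\<bar> powr \<kappa>)"]])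
    show "\<forall>\<^sub>F n in sequentially. norm (x n * exp ((x n)\<^sup>2 / 2) * (?A n - ?E n))
       \<le> x n * exp ((x n)\<^sup>2 / 2) * (real n * ((LINT y|D. exp (c * \<bar>y\<bar> powr \<kappa>)) * exp (- c * trunc n powr \<kappa>)))"
      using x_ge[of 0]
    proof eventually_elim
      case (elim n)
      have "\<bar>?A n - ?E n\<bar> \<le> real n * ((LINT y|D. exp (c * \<bar>y\<bar> powr \<kappa>)) * exp (- c * trunc n powr \<kappa>))"
        by (rule truncation_error[OF prob indep]) (use elim law in \<open>auto simp: trunc_def\<close>)
      from mult_left_mono[OF this, of "x n * exp ((x n)\<^sup>2 / 2)"]
      show ?case using elim by (simp add: abs_mult)
    qed
  qed
  ultimately have "(\<lambda>n. x n * (exp ((x n)\<^sup>2 / 2) * ?E n) + x n * exp ((x n)\<^sup>2 / 2) * (?A n - ?E n)) \<longlonglongrightarrow> 1 / sqrt (2 * pi) + 0"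
    by (rule tendsto_add)
  moreover have "x n * (exp ((x n)\<^sup>2 / 2) * ?E n) + x n * exp ((x n)\<^sup>2 / 2) * (?A n - ?E n) = x n * exp ((x n)\<^sup>2 / 2) * ?A n" for n
    by (simp add: algebra_simps)
  ultimately show ?thesis by (simp only: add_0_right)
qed

end

section \<open>Gaussian tails and quantiles\<close>

interpretation std_normal: real_distribution std_normal_distribution
  by (rule real_dist_normal_dist)

lemma measure_std_normal:
  "A \<in> sets borel \<Longrightarrow> measure std_normal_distribution A = (LINT s|lborel. indicator A s * std_normal_density s)"
proof -
  assume [measurable]: "A \<in> sets borel"
  have "measure std_normal_distribution A = (LINT s|std_normal_distribution. indicator A s)" by simp
  also have "\<dots> = (LINT s|lborel. std_normal_density s *\<^sub>R indicator A s)"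
    by (rule integral_density) auto
  finally show ?thesis by (simp add: mult.commute)
qed

lemma std_normal_tail: "1 - cdf std_normal_distribution t = measure std_normal_distribution {t<..}"
proof -
  have "{t<..} = UNIV - {..t}" by auto
  then show ?thesis using std_normal.prob_compl[of "{..t}"] by (simp add: cdf_def)
qed

text \<open>Substituting \<open>s = x n + v / x n\<close> in the tail integral extracts
  \<open>exp (- (x n)\<^sup>2 / 2) / x n\<close> and leaves the integral of
  \<open>exp (- v - v\<^sup>2 / (2 * (x n)\<^sup>2)) / sqrt (2 * pi)\<close> over positive
  \<open>v\<close>, which converges by domination with \<open>exp (- v)\<close>.\<close>

lemma mills_ratio:
  fixes x :: "nat \<Rightarrow> real"
  assumes x: "filterlim x at_top sequentially"
  shows "(\<lambda>n. x n * exp ((x n)\<^sup>2 / 2) * (1 - cdf std_normal_distribution (x n))) \<longlonglongrightarrow> 1 / sqrt (2 * pi)"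
proof -
  let ?f = "\<lambda>n v. 1 / sqrt (2 * pi) * (exp (- v) * indicator {0<..} v * exp (- v\<^sup>2 / (2 * (x n)\<^sup>2)))"
  have int: "integrable lborel (\<lambda>v::real. exp (- v) * indicator {0<..} v)"
    and val: "(LINT v|lborel. exp (- v) * indicator {0<..} v) = (1 :: real)"
    using has_bochner_integral_I0i_power_exp_m[of 0] by (auto simp: has_bochner_integral_iff)
  have "(\<lambda>n. LINT v|lborel. ?f n v) \<longlonglongrightarrow> (LINT v|lborel. 1 / sqrt (2 * pi) * (exp (- v) * indicator {0<..} v))"
  proof (rule integral_dominated_convergence)
    show "integrable lborel (\<lambda>v. 1 / sqrt (2 * pi) * (exp (- v) * indicator {0<..} v))"
      by (intro integrable_mult_right int)
    show "AE v in lborel. (\<lambda>n. ?f n v) \<longlonglongrightarrow> 1 / sqrt (2 * pi) * (exp (- v) * indicator {0<..} v)"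
    proof (rule AE_I2)
      fix v :: real
      have "filterlim (\<lambda>n. 2 * (x n)\<^sup>2) at_top sequentially"
        by (intro filterlim_tendsto_pos_mult_at_top[OF tendsto_const] filterlim_pow_at_top x) auto
      then have "(\<lambda>n. - v\<^sup>2 / (2 * (x n)\<^sup>2)) \<longlonglongrightarrow> 0"
        by (intro tendsto_divide_0[OF tendsto_const] filterlim_at_top_imp_at_infinity)
      then have "(\<lambda>n. ?f n v) \<longlonglongrightarrow> 1 / sqrt (2 * pi) * (exp (- v) * indicator {0<..} v * exp 0)"
        by (intro tendsto_intros)
      then show "(\<lambda>n. ?f n v) \<longlonglongrightarrow> 1 / sqrt (2 * pi) * (exp (- v) * indicator {0<..} v)" by simp
    qed
    show "AE v in lborel. norm (?f n v) \<le> 1 / sqrt (2 * pi) * (exp (- v) * indicator {0<..} v)" for n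
    proof (rule AE_I2)
      fix v
      have "exp (- v) * indicator {0<..} v * exp (- v\<^sup>2 / (2 * (x n)\<^sup>2)) \<le> exp (- v) * indicator {0<..} v * 1"
        by (intro mult_left_mono) auto
      then show "norm (?f n v) \<le> 1 / sqrt (2 * pi) * (exp (- v) * indicator {0<..} v)"
        by (simp add: abs_mult divide_right_mono)
    qed
  qed auto
  then have lim: "(\<lambda>n. LINT v|lborel. ?f n v) \<longlonglongrightarrow> 1 / sqrt (2 * pi)"
    unfolding integral_mult_right_zero val by simp
  have "\<forall>\<^sub>F n in sequentially. x n > 0" using x by (auto simp: filterlim_at_top_dense)
  then have "\<forall>\<^sub>F n in sequentially. (LINT v|lborel. ?f n v) = x n * exp ((x n)\<^sup>2 / 2) * (1 - cdf std_normal_distribution (x n))"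
  proof eventually_elim
    case (elim n)
    have "(1 - cdf std_normal_distribution (x n)) = (LINT s|lborel. indicator {x n<..} s * std_normal_density s)"
      by (simp add: std_normal_tail measure_std_normal)
    also have "\<dots> = \<bar>1 / x n\<bar> *\<^sub>R (LINT v|lborel. indicator {x n<..} (x n + 1 / x n * v) * std_normal_density (x n + 1 / x n * v))"
      by (rule lborel_integral_real_affine) (use elim in simp)
    also have "(LINT v|lborel. indicator {x n<..} (x n + 1 / x n * v) * std_normal_density (x n + 1 / x n * v))
       = (LINT v|lborel. exp (- (x n)\<^sup>2 / 2) * ?f n v)"
    proof (rule Bochner_Integration.integral_cong[OF refl])
      fix v
      have "- (x n + 1 / x n * v)\<^sup>2 / 2 = - (x n)\<^sup>2 / 2 + (- v + - v\<^sup>2 / (2 * (x n)\<^sup>2))"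
        using elim by (simp add: power2_eq_square field_simps)
      then have "std_normal_density (x n + 1 / x n * v) = 1 / sqrt (2 * pi) * (exp (- (x n)\<^sup>2 / 2) * (exp (- v) * exp (- v\<^sup>2 / (2 * (x n)\<^sup>2))))"
        unfolding std_normal_density_def by (simp only: exp_add)
      moreover have "indicator {x n<..} (x n + 1 / x n * v) = (indicator {0<..} v :: real)"
        using elim by (auto simp: indicator_def zero_less_divide_iff)
      ultimately show "indicator {x n<..} (x n + 1 / x n * v) * std_normal_density (x n + 1 / x n * v) = exp (- (x n)\<^sup>2 / 2) * ?f n v"
        by simp
    qed
    also have "\<dots> = exp (- (x n)\<^sup>2 / 2) * (LINT v|lborel. ?f n v)" by (rule integral_mult_right_zero)
    finally have "x n * exp ((x n)\<^sup>2 / 2) * (1 - cdf std_normal_distribution (x n))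
      = (x n * \<bar>1 / x n\<bar>) * (exp ((x n)\<^sup>2 / 2) * exp (- (x n)\<^sup>2 / 2)) * (LINT v|lborel. ?f n v)"
      by (simp only: real_scaleR_def mult_ac)
    also have "x n * \<bar>1 / x n\<bar> = 1" using elim by simp
    also have "exp ((x n)\<^sup>2 / 2) * exp (- (x n)\<^sup>2 / 2) = 1" by (simp flip: exp_add)
    finally show ?case by (simp only: mult_1_left)
  qed
  with lim show ?thesis by (rule Lim_transform_eventually)
qed

section \<open>The Gaussian distribution function and its quantiles\<close>

text \<open>Equality would make an interval of positive length a null set, although the density is
  positive everywhere.\<close>

lemma cdf_std_normal_strict_mono:
  assumes "a < b"
  shows "cdf std_normal_distribution a < cdf std_normal_distribution b"
proof (rule ccontr)
  assume "\<not> ?thesis"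
  then have "cdf std_normal_distribution a = cdf std_normal_distribution b"
    using std_normal.cdf_nondecreasing[of a b] assms by simp
  then have "measure std_normal_distribution {a<..b} = 0"
    using std_normal.cdf_diff_eq[OF assms] by simp
  then have "emeasure std_normal_distribution {a<..b} = 0" by (simp add: std_normal.emeasure_eq_measure)
  moreover have "\<not> std_normal_density s \<le> 0" for s by (simp add: not_le normal_density_pos)
  ultimately have "AE s in lborel. s \<notin> {a<..b}"
    by (subst (asm) emeasure_density) (auto simp: nn_integral_0_iff_AE indicator_def normal_density_pos ennreal_eq_0_iff not_le split: if_splits elim!: eventually_mono)
  then have "emeasure lborel {a<..b} = 0"
    by (subst (asm) AE_iff_measurable[of "{a<..b}"]) auto
  then show False using assms by simp
qed

text \<open>The distribution function has no jumps, so the intermediate value theorem gives a point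
  with value \<open>q\<close>; by strict monotonicity the set in the definition of the quantile is
  the closed ray from that point.\<close>

lemma cdf_gauss_quantile:
  assumes q: "0 < q" "q < 1"
  shows "cdf std_normal_distribution (gauss_quantile q) = q"
proof -
  let ?F = "cdf std_normal_distribution"
  have "measure std_normal_distribution {t} = 0" for t
    by (subst measure_std_normal) (auto intro!: integral_eq_zero_AE simp: indicator_def intro: AE_mp[OF AE_lborel_singleton[of t]])
  then have cont: "isCont ?F t" for t by (simp add: std_normal.isCont_cdf)
  have "\<forall>\<^sub>F t in at_bot. ?F t < q" using std_normal.cdf_lim_at_bot by (rule order_tendstoD) (rule q)
  then obtain l where l: "\<And>t. t \<le> l \<Longrightarrow> ?F t < q" by (auto simp: eventually_at_bot_linorder)
  have "\<forall>\<^sub>F t in at_top. ?F t > q" using std_normal.cdf_lim_at_top_prob by (rule order_tendstoD) (rule q)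
  then obtain u where u: "\<And>t. t \<ge> u \<Longrightarrow> ?F t > q" by (auto simp: eventually_at_top_linorder)
  have "l \<le> max l u" "?F l \<le> q" "q \<le> ?F (max l u)" using l[of l] u[of "max l u"] by auto
  then obtain t where t: "?F t = q" using IVT[of ?F l q "max l u"] cont by auto
  have "{s. q \<le> ?F s} = {t..}"
    using cdf_std_normal_strict_mono t by (auto simp: not_le[symmetric] std_normal.cdf_nondecreasing)
  then show ?thesis using t by (simp add: gauss_quantile_def)
qed

lemma gauss_quantile_cdf: "gauss_quantile (cdf std_normal_distribution t) = t"
proof -
  have "{s. cdf std_normal_distribution t \<le> cdf std_normal_distribution s} = {t..}"
    using cdf_std_normal_strict_mono by (auto simp: not_le[symmetric] std_normal.cdf_nondecreasing)
  then show ?thesis by (simp add: gauss_quantile_def)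
qed

lemma cdf_std_normal_minus: "cdf std_normal_distribution (- t) = 1 - cdf std_normal_distribution t"
proof -
  have "cdf std_normal_distribution (- t) = (LINT s|lborel. indicator {..-t} s * std_normal_density s)"
    by (simp add: cdf_def measure_std_normal)
  also have "\<dots> = \<bar>-1\<bar> *\<^sub>R (LINT s|lborel. indicator {..-t} (0 + - 1 * s) * std_normal_density (0 + - 1 * s))"
    by (rule lborel_integral_real_affine) simp
  also have "\<dots> = (LINT s|lborel. indicator {t<..} s * std_normal_density s)"
  proof -
    have "(LINT s|lborel. indicator {..-t} (0 + - 1 * s) * std_normal_density (0 + - 1 * s)) = (LINT s|lborel. indicator {t<..} s * std_normal_density s)"
      by (rule integral_cong_AE) (auto simp: indicator_def normal_density_def intro: AE_mp[OF AE_lborel_singleton[of t]])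
    then show ?thesis by simp
  qed
  also have "\<dots> = 1 - cdf std_normal_distribution t" by (simp add: std_normal_tail measure_std_normal)
  finally show ?thesis .
qed

lemma gauss_quantile_symmetric:
  assumes "0 < q" "q < 1"
  shows "gauss_quantile q = - gauss_quantile (1 - q)"
  using gauss_quantile_cdf[of "- gauss_quantile (1 - q)"] assms
  by (simp add: cdf_std_normal_minus cdf_gauss_quantile)

lemma gauss_quantile_at_top:
  assumes a: "\<And>n. 0 < a n \<and> a n < 1" and lim: "a \<longlonglongrightarrow> 0"
  shows "filterlim (\<lambda>n. gauss_quantile (1 - a n)) at_top sequentially"
  unfolding filterlim_at_top
proof
  fix t
  let ?F = "cdf std_normal_distribution"
  have "?F t < 1" using cdf_std_normal_strict_mono[of t "t + 1"] std_normal.cdf_bounded_prob[of "t + 1"] by simp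
  then have "\<forall>\<^sub>F n in sequentially. a n < 1 - ?F t" using lim by (intro order_tendstoD) auto
  then show "\<forall>\<^sub>F n in sequentially. t \<le> gauss_quantile (1 - a n)"
  proof eventually_elim
    case (elim n)
    show ?case
    proof (rule ccontr)
      assume "\<not> ?thesis"
      then have "?F (gauss_quantile (1 - a n)) \<le> ?F t" by (intro std_normal.cdf_nondecreasing) simp
      then show False using elim a[of n] by (simp add: cdf_gauss_quantile)
    qed
  qed
qed

section \<open>Confidence intervals\<close>

text \<open>This explains the Linnik exponent: it satisfies
  \<open>\<gamma> * (2 - \<kappa>) = \<kappa> / 2\<close>, so the quantity in \<open>x_trunc\<close>
  is exactly \<open>(x n / n powr \<gamma>) powr (2 - \<kappa>)\<close>. The bound \<gamma> \<le>
  1/4 gives the condition \<open>x_sq\<close>.\<close>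

lemma (in subexponential_law) moderate_deviation_powr:
  assumes gamma: "0 < \<gamma>" "\<gamma> \<le> 1 / 4" and kappa_eq: "\<kappa> = 4 * \<gamma> / (2 * \<gamma> + 1)"
    and top: "filterlim x at_top sequentially" and small: "x \<in> o(\<lambda>n. real n powr \<gamma>)"
  shows "moderate_deviation D c \<kappa> g x"
proof unfold_locales
  have lim: "(\<lambda>n. x n / real n powr \<gamma>) \<longlonglongrightarrow> 0" using small by (rule smalloD_tendsto)
  have pos: "\<forall>\<^sub>F n in sequentially. x n > 0" using top by (auto simp: filterlim_at_top_dense)
  show "(\<lambda>n. (x n)\<^sup>2 / sqrt (real n)) \<longlonglongrightarrow> 0"
  proof (rule Lim_null_comparison)
    show "(\<lambda>n. (x n / real n powr \<gamma>)\<^sup>2) \<longlonglongrightarrow> 0" using tendsto_power[OF lim, of 2] by simp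
    show "\<forall>\<^sub>F n in sequentially. norm ((x n)\<^sup>2 / sqrt (real n)) \<le> (x n / real n powr \<gamma>)\<^sup>2"
      using eventually_gt_at_top[of 0]
    proof eventually_elim
      case (elim n)
      have "(real n powr \<gamma>)\<^sup>2 = real n powr (\<gamma> * 2)" using elim by (simp add: powr_powr flip: powr_numeral)
      also have "\<dots> \<le> real n powr (1 / 2)" using elim gamma by (intro powr_mono) auto
      finally have "(real n powr \<gamma>)\<^sup>2 \<le> sqrt (real n)" using elim by (simp add: powr_half_sqrt)
      then show ?case using elim by (auto simp: power_divide intro!: divide_left_mono)
    qed
  qed
  show "(\<lambda>n. (x n)\<^sup>2 / (sqrt (real n) * x n) powr \<kappa>) \<longlonglongrightarrow> 0"
  proof (rule Lim_transform_eventually)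
    show "(\<lambda>n. (x n / real n powr \<gamma>) powr (2 - \<kappa>)) \<longlonglongrightarrow> 0"
      using pos kappa by (intro tendsto_zero_powrI[OF lim tendsto_const]) (auto elim!: eventually_mono)
    show "\<forall>\<^sub>F n in sequentially. (x n / real n powr \<gamma>) powr (2 - \<kappa>) = (x n)\<^sup>2 / (sqrt (real n) * x n) powr \<kappa>"
      using pos eventually_gt_at_top[of 0]
    proof eventually_elim
      case (elim n)
      have e: "\<gamma> * (2 - \<kappa>) = 1 / 2 * \<kappa>" using gamma by (simp add: kappa_eq divide_simps)
      have "(x n / real n powr \<gamma>) powr (2 - \<kappa>) = x n powr (2 - \<kappa>) / real n powr (\<gamma> * (2 - \<kappa>))"
        using elim by (simp add: powr_divide powr_powr)
      also have "\<dots> = x n powr 2 / x n powr \<kappa> / (real n powr (1 / 2)) powr \<kappa>"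
        unfolding e using elim by (simp add: powr_diff powr_powr)
      also have "\<dots> = (x n)\<^sup>2 / (sqrt (real n) * x n) powr \<kappa>"
        using elim by (simp add: powr_half_sqrt powr_mult)
      finally show ?case .
    qed
  qed
qed (rule top)

text \<open>Multiplied by \<open>q n * exp ((q n)\<^sup>2 / 2)\<close>, both the probability and
  \<open>a n\<close> tend to \<open>1 / sqrt (2 * pi)\<close>: the former by
  \<open>moderate_deviation_limit\<close>, the latter by Mills' ratio, as \<open>a n\<close> is the
  Gaussian tail at \<open>q n\<close>.\<close>

theorem adjusted_quantile_tail:
  fixes M :: "nat \<Rightarrow> 'a measure" and X :: "nat \<Rightarrow> nat \<Rightarrow> 'a \<Rightarrow> real" and a :: "nat \<Rightarrow> real"
  defines "q \<equiv> (\<lambda>n. gauss_quantile (1 - a n))"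
  assumes law: "subexponential_law D c (4 * \<gamma> / (2 * \<gamma> + 1)) g" and gamma: "0 < \<gamma>" "\<gamma> \<le> 1 / 4"
    and a: "\<And>n. 0 < a n \<and> a n < 1" "a \<longlonglongrightarrow> 0" and small: "q \<in> o(\<lambda>n. real n powr \<gamma>)"
    and prob: "\<And>n. prob_space (M n)"
    and indep: "\<And>n. prob_space.indep_vars (M n) (\<lambda>_. borel) (X n) {1..n}"
    and X: "\<And>n i. i \<in> {1..n} \<Longrightarrow> distr (M n) borel (X n i) = D"
    and B: "{0<..} \<subseteq> B" "B \<subseteq> {0..}"
  shows "(\<lambda>n. measure (M n) {\<omega> \<in> space (M n).
      (\<Sum>i=1..n. X n i \<omega>) / sqrt (real n) - (q n + g / (6 * sqrt (real n)) * (q n)\<^sup>2) \<in> B}) \<sim>[sequentially] a"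
proof -
  have top: "filterlim q at_top sequentially" unfolding q_def using a by (rule gauss_quantile_at_top)
  interpret moderate_deviation D c "4 * \<gamma> / (2 * \<gamma> + 1)" g q
    by (rule subexponential_law.moderate_deviation_powr[OF law gamma refl top small])
  let ?p = "\<lambda>n. measure (M n) {\<omega> \<in> space (M n). std_sum n (X n) \<omega> \<in> B}"
  let ?e = "\<lambda>n. q n * exp ((q n)\<^sup>2 / 2)"
  have "(\<lambda>n. ?e n * ?p n) \<longlonglongrightarrow> 1 / sqrt (2 * pi)"
    using prob indep X B by (rule moderate_deviation_limit)
  moreover have "(\<lambda>n. ?e n * a n) \<longlonglongrightarrow> 1 / sqrt (2 * pi)"
    using mills_ratio[OF top] a by (simp add: q_def cdf_gauss_quantile)
  ultimately have "(\<lambda>n. (?e n * ?p n) / (?e n * a n)) \<longlonglongrightarrow> (1 / sqrt (2 * pi)) / (1 / sqrt (2 * pi))"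
    by (rule tendsto_divide) simp
  then have "(\<lambda>n. (?e n * ?p n) / (?e n * a n)) \<longlonglongrightarrow> 1" by simp
  moreover have "\<forall>\<^sub>F n in sequentially. (?e n * ?p n) / (?e n * a n) = ?p n / a n"
    using x_ge[of 1] by eventually_elim simp
  ultimately have "(\<lambda>n. ?p n / a n) \<longlonglongrightarrow> 1" by (rule Lim_transform_eventually)
  then have "?p \<sim>[sequentially] a" by (rule asymp_equivI')
  then show ?thesis by (simp only: std_sum_def level_def)
qed

section \<open>The sample and its standardisation\<close>

lemma real_distribution_shift_law:
  assumes "real_distribution P"
  shows "real_distribution (shift_law P m)"
proof -
  interpret real_distribution P by fact
  show ?thesis unfolding shift_law_def by (rule real_distribution_distr) simp
qed

lemma prob_space_sample_law:
  assumes "real_distribution P"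
  shows "prob_space (sample_law P m)"
  unfolding sample_law_def using real_distribution_shift_law[OF assms]
  by (intro prob_space_PiM) (simp add: real_distribution_def)

text \<open>Under a product measure the joint law of the coordinates is the product of their
  marginals, and measurable functions of single coordinates inherit independence.\<close>

lemma indep_vars_sample_law:
  assumes P: "real_distribution P" and [measurable]: "f \<in> borel_measurable borel"
  shows "prob_space.indep_vars (sample_law P m) (\<lambda>_. borel) (\<lambda>i \<omega>. f (\<omega> i)) I"
proof -
  let ?S = "shift_law P m"
  interpret S: real_distribution ?S by (rule real_distribution_shift_law[OF P])
  interpret prod: product_prob_space "\<lambda>_. ?S" "UNIV :: nat set" ..
  interpret L: prob_space "sample_law P m" by (rule prob_space_sample_law[OF P])
  have "L.indep_vars (\<lambda>_. ?S) (\<lambda>i \<omega>. \<omega> i) UNIV"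
  proof (subst L.indep_vars_iff_distr_eq_PiM)
    show "distr (sample_law P m) (\<Pi>\<^sub>M i\<in>UNIV. ?S) (\<lambda>\<omega>. \<lambda>i\<in>UNIV. \<omega> i)
        = (\<Pi>\<^sub>M i\<in>UNIV. distr (sample_law P m) ?S (\<lambda>\<omega>. \<omega> i))"
      unfolding sample_law_def by (simp add: prod.PiM_component restrict_UNIV)
  qed (auto simp: sample_law_def)
  then have "L.indep_vars (\<lambda>_. ?S) (\<lambda>i \<omega>. \<omega> i) I" by (rule L.indep_vars_subset) simp
  then show ?thesis by (rule L.indep_vars_compose2) simp
qed

text \<open>For the standardising map \<open>s * (y - m) / \<sigma>\<close> the right-hand side is
  free of \<open>m\<close>, so samples drawn under varying parameters share one standardised
  law.\<close>

lemma distr_sample_law: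
  assumes P: "real_distribution P" and [measurable]: "f \<in> borel_measurable borel"
  shows "distr (sample_law P m) borel (\<lambda>\<omega>. f (\<omega> i)) = distr P borel (\<lambda>y. f (y + m))"
proof -
  let ?S = "shift_law P m"
  interpret P: real_distribution P by fact
  interpret S: real_distribution ?S by (rule real_distribution_shift_law[OF P])
  interpret prod: product_prob_space "\<lambda>_. ?S" "UNIV :: nat set" ..
  have "distr (sample_law P m) borel (\<lambda>\<omega>. f (\<omega> i)) = distr (distr (sample_law P m) ?S (\<lambda>\<omega>. \<omega> i)) borel f"
    by (subst distr_distr) (auto simp: sample_law_def comp_def)
  also have "distr (sample_law P m) ?S (\<lambda>\<omega>. \<omega> i) = ?S"
    unfolding sample_law_def by (simp add: prod.PiM_component)
  also have "distr ?S borel f = distr P borel (\<lambda>y. f (y + m))"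
    unfolding shift_law_def by (subst distr_distr) (auto simp: comp_def)
  finally show ?thesis .
qed

text \<open>The sign \<open>s\<close> covers the standardised observation and its negative; the
  latter has skewness of opposite sign. Scaling by \<open>\<sigma>\<close> turns the Linnik exponent
  into \<open>\<sigma> powr \<kappa> * \<bar>y\<bar> powr \<kappa>\<close>, which fixes the constant
  \<open>c\<close>.\<close>

lemma subexponential_law_standardized:
  assumes family: "shift_family P \<sigma>" and gamma: "1 / 6 < \<gamma>" "\<gamma> \<le> 1 / 4"
    and linnik: "linnik_condition \<gamma> (shift_law P \<mu>) \<mu>" and s: "\<bar>s\<bar> = 1"
  shows "subexponential_law (distr P borel (\<lambda>y. s * y / \<sigma>)) (\<sigma> powr (4 * \<gamma> / (2 * \<gamma> + 1)))
    (4 * \<gamma> / (2 * \<gamma> + 1)) (s * skewness (shift_law P \<mu>))"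
proof -
  define \<kappa> where "\<kappa> = 4 * \<gamma> / (2 * \<gamma> + 1)"
  have P: "real_distribution P" and \<sigma>: "\<sigma> > 0" using family by (auto simp: shift_family_def)
  interpret real_distribution P by fact
  let ?D = "distr P borel (\<lambda>y. s * y / \<sigma>)"
  have shift: "(LINT y|shift_law P m. f y) = (LINT y|P. f (y + m))" if "f \<in> borel_measurable borel" for f :: "real \<Rightarrow> real" and m
    unfolding shift_law_def using that by (intro integral_distr) auto
  have fam: "prob_space.expectation (shift_law P m) (\<lambda>x. x) = m" "prob_space.variance (shift_law P m) (\<lambda>x. x) = \<sigma>\<^sup>2" for m
    using family unfolding shift_family_def by blast+
  \<comment> \<open>The member with parameter 0 is \<open>P\<close> itself, so \<open>P\<close> is
    centred with variance \<open>\<sigma>\<^sup>2\<close>.\<close>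
  have mean: "(LINT y|P. y) = 0" using fam(1)[of 0] by (simp add: shift)
  have var: "(LINT y|P. y\<^sup>2) = \<sigma>\<^sup>2" using fam(2)[of 0] by (simp add: shift mean)
  have sk: "skewness (shift_law P \<mu>) = (LINT y|P. y ^ 3) / \<sigma> ^ 3"
    unfolding skewness_def fam using \<sigma> by (simp add: shift var)
  have D: "(LINT y|?D. f y) = (LINT y|P. f (s * y / \<sigma>))" if "f \<in> borel_measurable borel" for f :: "real \<Rightarrow> real"
    using that by (intro integral_distr) auto
  have s2: "s\<^sup>2 = 1" and s3: "s ^ 3 = s" using s by (auto simp: abs_if power2_eq_square power3_eq_cube split: if_splits)
  have "real_distribution ?D" by (rule real_distribution_distr) simp
  moreover have "subexponential_law_axioms ?D (\<sigma> powr \<kappa>) \<kappa> (s * skewness (shift_law P \<mu>))"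
  proof
    show "\<sigma> powr \<kappa> > 0" using \<sigma> by simp
    show "1 / 2 \<le> \<kappa>" "\<kappa> < 1" using gamma by (auto simp: \<kappa>_def field_simps)
    have "integrable P (\<lambda>y. exp (\<bar>y\<bar> powr \<kappa>))"
      using linnik unfolding linnik_condition_def shift_law_def \<kappa>_def by (subst (asm) integrable_distr_eq) auto
    moreover have "\<sigma> powr \<kappa> * \<bar>s * y / \<sigma>\<bar> powr \<kappa> = \<bar>y\<bar> powr \<kappa>" for y
      using \<sigma> s by (simp add: abs_mult abs_divide flip: powr_mult)
    ultimately show "integrable ?D (\<lambda>y. exp (\<sigma> powr \<kappa> * \<bar>y\<bar> powr \<kappa>))"
      by (subst integrable_distr_eq) auto
    show "(LINT y|?D. y) = 0" by (simp add: D mean)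
    show "(LINT y|?D. y\<^sup>2) = 1" using \<sigma> by (simp add: D power_divide power_mult_distrib s2 var)
    show "(LINT y|?D. y ^ 3) = s * skewness (shift_law P \<mu>)" by (simp add: D power_divide power_mult_distrib s3 sk)
  qed
  ultimately show ?thesis unfolding \<kappa>_def subexponential_law_def by blast
qed

text \<open>Both quantiles tend to infinity, so they are eventually nonnegative and each is bounded
  in absolute value by their maximum.\<close>

lemma osipov_quantile_small:
  assumes "osipov_condition \<gamma> \<alpha> \<beta>" and a: "\<And>n. 0 < \<alpha> n \<and> \<alpha> n < 1" "\<alpha> \<longlonglongrightarrow> 0"
    and b: "\<And>n. 0 < \<beta> n \<and> \<beta> n < 1" "\<beta> \<longlonglongrightarrow> 0"
  shows "(\<lambda>n. gauss_quantile (1 - \<alpha> n)) \<in> o(\<lambda>n. real n powr \<gamma>)"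
    and "(\<lambda>n. gauss_quantile (1 - \<beta> n)) \<in> o(\<lambda>n. real n powr \<gamma>)"
proof -
  have top: "\<forall>\<^sub>F n in sequentially. gauss_quantile (1 - \<alpha> n) \<ge> 0" "\<forall>\<^sub>F n in sequentially. gauss_quantile (1 - \<beta> n) \<ge> 0"
    using gauss_quantile_at_top[OF a] gauss_quantile_at_top[OF b] by (auto simp: filterlim_at_top)
  let ?m = "\<lambda>n. max (gauss_quantile (1 - \<alpha> n)) (gauss_quantile (1 - \<beta> n))"
  have small: "?m \<in> o(\<lambda>n. real n powr \<gamma>)" using assms(1) by (simp add: osipov_condition_def)
  have "(\<lambda>n. gauss_quantile (1 - \<alpha> n)) \<in> O(?m)"
    by (rule landau_o.big_mono) (use top in \<open>auto elim: eventually_elim2\<close>)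
  then show "(\<lambda>n. gauss_quantile (1 - \<alpha> n)) \<in> o(\<lambda>n. real n powr \<gamma>)" using small by (rule landau_o.big_small_trans)
  have "(\<lambda>n. gauss_quantile (1 - \<beta> n)) \<in> O(?m)"
    by (rule landau_o.big_mono) (use top in \<open>auto elim: eventually_elim2\<close>)
  then show "(\<lambda>n. gauss_quantile (1 - \<beta> n)) \<in> o(\<lambda>n. real n powr \<gamma>)" using small by (rule landau_o.big_small_trans)
qed

section \<open>Coverage events in terms of standardised sums\<close>

lemma standardized_sum:
  assumes "n > 0" "\<sigma> > 0"
  shows "(\<Sum>i=1..n. s * (\<omega> i - m) / \<sigma>) / sqrt (real n) = s * sqrt (real n) / \<sigma> * (sample_mean n \<omega> - m)"
proof -
  have "(\<Sum>i=1..n. s * (\<omega> i - m) / \<sigma>) = s / \<sigma> * (\<Sum>i=1..n. \<omega> i - m)"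
    by (simp add: sum_distrib_left)
  also have "(\<Sum>i=1..n. \<omega> i - m) = real n * (sample_mean n \<omega> - m)"
    using assms by (simp add: sample_mean_def sum_subtractf field_simps)
  finally have "(\<Sum>i=1..n. s * (\<omega> i - m) / \<sigma>) / sqrt (real n) = s / \<sigma> * (real n / sqrt (real n)) * (sample_mean n \<omega> - m)"
    by simp
  also have "real n / sqrt (real n) = sqrt (real n)" using assms by (simp add: real_div_sqrt)
  finally show ?thesis by simp
qed

text \<open>The interval is closed at its left end, so missing \<open>\<mu>\<close> is a strict
  inequality and corresponds to the open half-line. The factor 1 plays the role of the sign
  \<open>s\<close>.\<close>

lemma not_covers_iff:
  assumes "n > 0" "\<sigma> > 0"
  shows "\<mu> \<notin> ACI_upper1 \<sigma> g a n \<omega> \<longleftrightarrow>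
    (\<Sum>i=1..n. 1 * (\<omega> i - \<mu>) / \<sigma>) / sqrt (real n) - (gauss_quantile (1 - a) + g / (6 * sqrt (real n)) * (gauss_quantile (1 - a))\<^sup>2) \<in> {0<..}"
  unfolding standardized_sum[OF assms] ACI_upper1_def adj_quantile1_def
  using assms by (auto simp: not_le field_simps)

text \<open>This is where the modified local parameter comes from. Its distance from
  \<open>\<mu>\<close> is \<open>\<sigma> / sqrt n\<close> times the sum of the adjusted quantile
  for \<open>a\<close> with skewness \<open>g\<close> and the one for \<open>b\<close> with skewness
  \<open>- g\<close>; the first cancels against the interval's own shift. By Gaussian symmetry the
  quantile of order \<open>b\<close> enters as minus that of order \<open>1 - b\<close>.\<close>

lemma covers_iff:
  assumes n: "n > 0" and \<sigma>: "\<sigma> > 0" and b: "0 < b" "b < 1"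
  shows "\<mu> \<in> ACI_upper1 \<sigma> g a n \<omega> \<longleftrightarrow>
    (\<Sum>i=1..n. -1 * (\<omega> i - local_param1 \<mu> \<sigma> g a b n) / \<sigma>) / sqrt (real n)
      - (gauss_quantile (1 - b) + (-1 * g) / (6 * sqrt (real n)) * (gauss_quantile (1 - b))\<^sup>2) \<in> {0..}"
proof -
  define r where "r = sqrt (real n)"
  have r: "r > 0" and nr: "real n = r * r" using n by (simp_all add: r_def)
  define u where "u = gauss_quantile (1 - a)"
  define v where "v = gauss_quantile (1 - b)"
  define S where "S = sample_mean n \<omega>"
  have m: "local_param1 \<mu> \<sigma> g a b n = \<mu> + \<sigma> / r * (u + v) + \<sigma> * g / (6 * (r * r)) * (u\<^sup>2 - v\<^sup>2)"
    unfolding local_param1_def local_param_def gauss_quantile_symmetric[OF b] by (simp add: u_def v_def r_def)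
  have "-1 * r / \<sigma> * (S - local_param1 \<mu> \<sigma> g a b n) - (v + (-1 * g) / (6 * r) * v\<^sup>2)
     = r / \<sigma> * (\<mu> - (S - \<sigma> / r * (u + g / (6 * r) * u\<^sup>2)))"
    unfolding m using r \<sigma> by (simp add: field_simps power2_eq_square)
  moreover have "0 \<le> r / \<sigma> * d \<longleftrightarrow> 0 \<le> d" for d
    using r \<sigma> by (auto simp: zero_le_mult_iff zero_le_divide_iff)
  then have "0 \<le> r / \<sigma> * (\<mu> - (S - \<sigma> / r * (u + g / (6 * r) * u\<^sup>2))) \<longleftrightarrow> S - \<sigma> / r * (u + g / (6 * r) * u\<^sup>2) \<le> \<mu>"
    by (simp only: diff_ge_0_iff_ge)
  ultimately show ?thesis
    unfolding standardized_sum[OF n \<sigma>] ACI_upper1_def adj_quantile1_def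
    unfolding r_def[symmetric] u_def[symmetric] v_def[symmetric] S_def[symmetric]
    by simp
qed

theorem theorem1:
  fixes P :: "real measure" and \<mu> \<sigma> \<gamma> g\<^sub>1 :: real and \<alpha> \<beta> :: "nat \<Rightarrow> real"
  assumes family: "shift_family P \<sigma>"
    and skew: "g\<^sub>1 = skewness (shift_law P \<mu>)"
    and gamma: "1 / 6 < \<gamma>" "\<gamma> \<le> 1 / 4"
    and alpha_range: "\<And>n. 0 < \<alpha> n \<and> \<alpha> n < 1"
    and beta_range: "\<And>n. 0 < \<beta> n \<and> \<beta> n < 1"
    and alpha_lim: "decseq \<alpha>" "\<alpha> \<longlonglongrightarrow> 0"
    and beta_lim: "decseq \<beta>" "\<beta> \<longlonglongrightarrow> 0"
    and linnik: "linnik_condition \<gamma> (shift_law P \<mu>) \<mu>"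
    and osipov: "osipov_condition \<gamma> \<alpha> \<beta>"
  shows "(\<lambda>n. measure (sample_law P \<mu>)
              {x \<in> space (sample_law P \<mu>). \<mu> \<notin> ACI_upper1 \<sigma> g\<^sub>1 (\<alpha> n) n x})
           \<sim>[sequentially] \<alpha> \<and>
         (\<lambda>n. measure (sample_law P (local_param1 \<mu> \<sigma> g\<^sub>1 (\<alpha> n) (\<beta> n) n))
              {x \<in> space (sample_law P (local_param1 \<mu> \<sigma> g\<^sub>1 (\<alpha> n) (\<beta> n) n)).
                 \<mu> \<in> ACI_upper1 \<sigma> g\<^sub>1 (\<alpha> n) n x})
           \<sim>[sequentially] \<beta>"
proof
  have P: "real_distribution P" and \<sigma>: "\<sigma> > 0" using family by (auto simp: shift_family_def)
  have \<gamma>0: "0 < \<gamma>" using gamma by simp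
  note small = osipov_quantile_small[OF osipov alpha_range alpha_lim(2) beta_range beta_lim(2)]
  note std = subexponential_law_standardized[OF family gamma linnik, folded skew]
  \<comment> \<open>One statement for both claims: the sign \<open>s\<close>, the centring
    \<open>m n\<close>, the levels and the half-line are left free.\<close>
  have tail: "(\<lambda>n. measure (sample_law P (m n)) {\<omega> \<in> space (sample_law P (m n)).
      (\<Sum>i=1..n. s * (\<omega> i - m n) / \<sigma>) / sqrt (real n)
      - (gauss_quantile (1 - a n) + (s * g\<^sub>1) / (6 * sqrt (real n)) * (gauss_quantile (1 - a n))\<^sup>2) \<in> B}) \<sim>[sequentially] a"
    if s: "\<bar>s\<bar> = 1" and a: "\<And>n. 0 < a n \<and> a n < 1" "a \<longlonglongrightarrow> 0" "(\<lambda>n. gauss_quantile (1 - a n)) \<in> o(\<lambda>n. real n powr \<gamma>)"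
      and B: "{0<..} \<subseteq> B" "B \<subseteq> {0..}" for s and a m :: "nat \<Rightarrow> real" and B
  proof (rule adjusted_quantile_tail[OF std[OF s] \<gamma>0 gamma(2) a, where M = "\<lambda>n. sample_law P (m n)" and X = "\<lambda>n i \<omega>. s * (\<omega> i - m n) / \<sigma>"])
    show "prob_space.indep_vars (sample_law P (m n)) (\<lambda>_. borel) (\<lambda>i \<omega>. s * (\<omega> i - m n) / \<sigma>) {1..n}" for n
      by (rule indep_vars_sample_law[OF P]) measurable
    show "distr (sample_law P (m n)) borel (\<lambda>\<omega>. s * (\<omega> i - m n) / \<sigma>) = distr P borel (\<lambda>y. s * y / \<sigma>)" for n i
      using distr_sample_law[OF P, of "\<lambda>y. s * (y - m n) / \<sigma>"] by simp
  qed (use prob_space_sample_law[OF P] B in auto)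
  show "(\<lambda>n. measure (sample_law P \<mu>)
              {x \<in> space (sample_law P \<mu>). \<mu> \<notin> ACI_upper1 \<sigma> g\<^sub>1 (\<alpha> n) n x}) \<sim>[sequentially] \<alpha>"
  \<comment> \<open>Positive sign, true parameter and open half-line. The events are identified for
    positive \<open>n\<close>, which suffices for an asymptotic statement.\<close>
  proof (rule asymp_equiv_transfer[OF tail[OF _ alpha_range alpha_lim(2) small(1), where s = 1 and m = "\<lambda>_. \<mu>" and B = "{0<..}"]])
    show "\<forall>\<^sub>F n in sequentially. measure (sample_law P \<mu>) {\<omega> \<in> space (sample_law P \<mu>).
        (\<Sum>i=1..n. 1 * (\<omega> i - \<mu>) / \<sigma>) / sqrt (real n)
        - (gauss_quantile (1 - \<alpha> n) + (1 * g\<^sub>1) / (6 * sqrt (real n)) * (gauss_quantile (1 - \<alpha> n))\<^sup>2) \<in> {0<..}}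
      = measure (sample_law P \<mu>) {x \<in> space (sample_law P \<mu>). \<mu> \<notin> ACI_upper1 \<sigma> g\<^sub>1 (\<alpha> n) n x}"
      using eventually_gt_at_top[of 0] by eventually_elim (simp only: not_covers_iff[OF _ \<sigma>] mult_1_left)
  qed auto
  show "(\<lambda>n. measure (sample_law P (local_param1 \<mu> \<sigma> g\<^sub>1 (\<alpha> n) (\<beta> n) n))
              {x \<in> space (sample_law P (local_param1 \<mu> \<sigma> g\<^sub>1 (\<alpha> n) (\<beta> n) n)).
                 \<mu> \<in> ACI_upper1 \<sigma> g\<^sub>1 (\<alpha> n) n x}) \<sim>[sequentially] \<beta>"
  \<comment> \<open>Negative sign, so the skewness enters as \<open>- g\<^sub>1\<close>; the sample
    is centred at the local parameter, and non-strict coverage gives the closed half-line.\<close>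
  proof (rule asymp_equiv_transfer[OF tail[OF _ beta_range beta_lim(2) small(2), where s = "-1"
        and m = "\<lambda>n. local_param1 \<mu> \<sigma> g\<^sub>1 (\<alpha> n) (\<beta> n) n" and B = "{0..}"]])
    let ?m = "\<lambda>n. local_param1 \<mu> \<sigma> g\<^sub>1 (\<alpha> n) (\<beta> n) n"
    show "\<forall>\<^sub>F n in sequentially. measure (sample_law P (?m n)) {\<omega> \<in> space (sample_law P (?m n)).
        (\<Sum>i=1..n. -1 * (\<omega> i - ?m n) / \<sigma>) / sqrt (real n)
        - (gauss_quantile (1 - \<beta> n) + (-1 * g\<^sub>1) / (6 * sqrt (real n)) * (gauss_quantile (1 - \<beta> n))\<^sup>2) \<in> {0..}}
      = measure (sample_law P (?m n)) {x \<in> space (sample_law P (?m n)). \<mu> \<in> ACI_upper1 \<sigma> g\<^sub>1 (\<alpha> n) n x}"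
      using eventually_gt_at_top[of 0]
    proof eventually_elim
      case (elim n)
      have "0 < \<beta> n" "\<beta> n < 1" using beta_range by auto
      from covers_iff[OF elim \<sigma> this, of \<mu> g\<^sub>1 "\<alpha> n"] show ?case by (simp only:)
    qed
  qed auto
qed

end
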